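(* Let $\boldsymbol{\lambda}=\{\lambda_n\}_{n\in\mathbb{N}}$ be a sequence of complex numbers and let $h_{\overline{\boldsymbol{\lambda}}}(z)=\sum_{n=0}^\infty\overline{\lambda_n}z^n$. Then the Hankel type operator $\mathcal{H}_{\boldsymbol{\lambda}}$ is compact on the Dirichlet space $\mathcal{D}$ if and only if $h_{\overline{\boldsymbol{\lambda}}}$ is analytic on $\mathbb{D}$ (i.e. the power series converges in $\mathbb{D}$) and the measure $|h_{\overline{\boldsymbol{\lambda}}}'(z)|^2dA(z)$ is a vanishing Carleson measure for the Dirichlet space $\mathcal{D}$.
   Context: $\mathbb{N}$ is the set of nonnegative integers, $\mathbb{D}$ is the open unit disk, $H(\mathbb{D})$ is the space of analytic functions on $\mathbb{D}$, and $dA=\pi^{-1}dx\,dy$ is normalized Lebesgue measure on $\mathbb{D}$. The Dirichlet space $\mathcal{D}$ is the Hilbert space of $f\in H(\mathbb{D})$ with $\|f\|_{\mathcal{D}}^2=|f(0)|^2+\int_{\mathbb{D}}|f'(z)|^2dA(z)<\infty$. For $f(z)=\sum_{k\ge0}a_kz^k\in H(\mathbb{D})$, the Hankel type operator is $\mathcal{H}_{\boldsymbol{\lambda}}(f)(z)=\sum_{n=0}^\infty\left(\sum_{k=0}^\infty\lambda_{n+k}a_k\right)z^n$, whenever the right-hand side makes sense and defines an analytic function in $\mathbb{D}$. It is compact on $\mathcal{D}$ if $\mathcal{H}_{\boldsymbol{\lambda}}(f)$ is well defined for every $f\in\mathcal{D}$ and $\mathcal{H}_{\boldsymbol{\lambda}}$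 is a compact linear operator from $\mathcal{D}$ to $\mathcal{D}$. A finite positive Borel measure $\nu$ on $\mathbb{D}$ is a Carleson measure for $\mathcal{D}$ if there is a constant $C>0$ such that $\left(\int_{\mathbb{D}}|f|^2d\nu\right)^{1/2}\le C\|f\|_{\mathcal{D}}$ for all $f\in\mathcal{D}$; it is a vanishing Carleson measure for $\mathcal{D}$ if the identity map $I_d:\mathcal{D}\to L^2(\mathbb{D},d\nu)$ is compact. *)

theory Defs
  imports "HOL-Analysis.Analysis" "HOL-Complex_Analysis.Complex_Analysis"
begin

abbreviation unit_disc :: "complex set" where
  "unit_disc \<equiv> ball 0 1"

definition disc_area :: "complex measure" where
  "disc_area = scale_measure (ennreal (1 / pi)) (restrict_space lborel unit_disc)"

(* Functions on the disc are represented by total functions whose values off the disc are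
   irrelevant: every notion below looks only at values (and derivatives) on the open disc. *)

definition dirichlet_space :: "(complex \<Rightarrow> complex) set" where
  "dirichlet_space =
     {f. f holomorphic_on unit_disc \<and> integrable disc_area (\<lambda>z. (cmod (deriv f z))\<^sup>2)}"

definition dirichlet_norm :: "(complex \<Rightarrow> complex) \<Rightarrow> real" where
  "dirichlet_norm f = sqrt ((cmod (f 0))\<^sup>2 + (\<integral>z. (cmod (deriv f z))\<^sup>2 \<partial>disc_area))"

definition L2_space :: "complex measure \<Rightarrow> (complex \<Rightarrow> complex) set" where
  "L2_space \<nu> = {f \<in> borel_measurable \<nu>. integrable \<nu> (\<lambda>z. (cmod (f z))\<^sup>2)}"

definition L2_norm_on :: "complex measure \<Rightarrow> (complex \<Rightarrow> complex) \<Rightarrow> real" where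
  "L2_norm_on \<nu> f = sqrt (\<integral>z. (cmod (f z))\<^sup>2 \<partial>\<nu>)"

(* Compact linear operator T from (V, N) to (W, M), in the sequential form: images of bounded
   sequences have subsequences converging in the target.  Elements are representatives, so
   equality in the target means distance zero: agreement on the disc for the Dirichlet norm,
   agreement almost everywhere for the L2 norm. *)
definition compact_linear_operator ::
  "(complex \<Rightarrow> complex) set \<Rightarrow> ((complex \<Rightarrow> complex) \<Rightarrow> real) \<Rightarrow>
   (complex \<Rightarrow> complex) set \<Rightarrow> ((complex \<Rightarrow> complex) \<Rightarrow> real) \<Rightarrow>
   ((complex \<Rightarrow> complex) \<Rightarrow> (complex \<Rightarrow> complex)) \<Rightarrow> bool" where
  "compact_linear_operator V N W M T \<longleftrightarrow>
     (\<forall>f\<in>V. T f \<in> W) \<and>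
     (\<forall>f\<in>V. \<forall>g\<in>V. M (\<lambda>z. T (\<lambda>w. f w + g w) z - (T f z + T g z)) = 0) \<and>
     (\<forall>f\<in>V. \<forall>c. M (\<lambda>z. T (\<lambda>w. c * f w) z - c * T f z) = 0) \<and>
     (\<forall>F :: nat \<Rightarrow> complex \<Rightarrow> complex.
        (\<forall>j. F j \<in> V) \<and> (\<exists>C. \<forall>j. N (F j) \<le> C) \<longrightarrow>
        (\<exists>g\<in>W. \<exists>r. strict_mono r \<and> (\<lambda>j. M (\<lambda>z. T (F (r j)) z - g z)) \<longlonglongrightarrow> 0))"

definition taylor_coeff :: "(complex \<Rightarrow> complex) \<Rightarrow> nat \<Rightarrow> complex" where
  "taylor_coeff f k = (deriv ^^ k) f 0 / fact k"

definition hankel_coeff :: "(nat \<Rightarrow> complex) \<Rightarrow> (complex \<Rightarrow> complex) \<Rightarrow> nat \<Rightarrow> complex" where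
  "hankel_coeff \<Lambda> f n = (\<Sum>k. \<Lambda> (n + k) * taylor_coeff f k)"

definition hankel_op :: "(nat \<Rightarrow> complex) \<Rightarrow> (complex \<Rightarrow> complex) \<Rightarrow> complex \<Rightarrow> complex" where
  "hankel_op \<Lambda> f z = (\<Sum>n. hankel_coeff \<Lambda> f n * z ^ n)"

(* All series involved converge; suminf is junk otherwise. *)
definition hankel_well_defined :: "(nat \<Rightarrow> complex) \<Rightarrow> (complex \<Rightarrow> complex) \<Rightarrow> bool" where
  "hankel_well_defined \<Lambda> f \<longleftrightarrow>
     (\<forall>n. summable (\<lambda>k. \<Lambda> (n + k) * taylor_coeff f k)) \<and>
     (\<forall>z\<in>unit_disc. summable (\<lambda>n. hankel_coeff \<Lambda> f n * z ^ n)) \<and>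
     hankel_op \<Lambda> f holomorphic_on unit_disc"

definition hankel_compact_on_dirichlet :: "(nat \<Rightarrow> complex) \<Rightarrow> bool" where
  "hankel_compact_on_dirichlet \<Lambda> \<longleftrightarrow>
     (\<forall>f\<in>dirichlet_space. hankel_well_defined \<Lambda> f) \<and>
     compact_linear_operator dirichlet_space dirichlet_norm dirichlet_space dirichlet_norm
       (hankel_op \<Lambda>)"

definition vanishing_carleson_dirichlet :: "complex measure \<Rightarrow> bool" where
  "vanishing_carleson_dirichlet \<nu> \<longleftrightarrow>
     finite_measure \<nu> \<and> space \<nu> = unit_disc \<and> sets \<nu> = sets (restrict_space borel unit_disc) \<and>
     compact_linear_operator dirichlet_space dirichlet_norm (L2_space \<nu>) (L2_norm_on \<nu>) (\<lambda>f. f)"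

definition conj_symbol :: "(nat \<Rightarrow> complex) \<Rightarrow> complex \<Rightarrow> complex" where
  "conj_symbol \<Lambda> z = (\<Sum>n. cnj (\<Lambda> n) * z ^ n)"

definition conj_symbol_analytic :: "(nat \<Rightarrow> complex) \<Rightarrow> bool" where
  "conj_symbol_analytic \<Lambda> \<longleftrightarrow>
     (\<forall>z\<in>unit_disc. summable (\<lambda>n. cnj (\<Lambda> n) * z ^ n)) \<and>
     conj_symbol \<Lambda> holomorphic_on unit_disc"

definition conj_symbol_measure :: "(nat \<Rightarrow> complex) \<Rightarrow> complex measure" where
  "conj_symbol_measure \<Lambda> =
     density disc_area (\<lambda>z. ennreal ((cmod (deriv (conj_symbol \<Lambda>) z))\<^sup>2))"

end

theory Submission
  imports Defs
begin

text \<open>Write \<open>h\<close> for the conjugate symbol, \<open>A\<^sup>2\<close> for the Bergman space and \<open>P\<close> for the Bergman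
  projection of \<open>L\<^sup>2\<close> onto \<open>A\<^sup>2\<close>. Comparing coefficients, the derivative of the Hankel operator
  applied to \<open>f\<close> has, up to conjugation of the coefficients, the expansion of \<open>P (cnj f * h')\<close>. Hence
  \<open>f h'\<close> splits in norm into this function and \<open>(I - P) (cnj f * h')\<close>. The latter is harmless: for
  \<open>f\<close> in the Dirichlet space, \<open>g \<mapsto> (I - P) (cnj f * g)\<close> is a Hilbert-Schmidt operator on \<open>A\<^sup>2\<close>, whose
  norm is dominated by the Dirichlet seminorm of \<open>f\<close>, and it tends to zero strongly when \<open>f\<close> tends
  to zero weakly. So along weakly null sequences in the Dirichlet space, the images under the Hankel operator tend
  to zero in norm if and only if \<open>f h'\<close> tends to zero in \<open>L\<^sup>2\<close>.\<close>

section \<open>Area measure on the disc\<close>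

text \<open>The obstacle is that \<open>cnj f * h'\<close> need not lie in \<open>L^2\<close> a
  priori; when the Hankel operator is given, this is part of what has to be shown. So
  \<open>P\<close> never occurs as an operator. From
  \<open>P (cnj z ^ k * z ^ m) = (m - k + 1) / (m + 1) * z ^ (m - k)\<close> for
  \<open>k \<le> m\<close>, and 0 otherwise, one reads off a coefficient sequence,
  \<open>bergman_coeff\<close>; estimates are made for finite sums and carried over by Fatou's
  lemma.

  The Hilbert-Schmidt bound rests on two facts. For fixed \<open>m\<close>, the functions
  \<open>(I - P) (cnj z ^ k * z ^ m)\<close> with different \<open>k\<close> are orthogonal, having
  different degrees under rotation. For fixed \<open>k\<close>, their squared norms weighted by
  \<open>m + 1\<close> add up to at most \<open>2 * k\<close>, which matches the Dirichlet seminorm.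
  Strong convergence comes from cutting \<open>g\<close> at an index \<open>M\<close>: the tail is
  small uniformly for \<open>f\<close> of bounded seminorm, the head is governed by the Bergman norm
  of \<open>f\<close>.

  Both sides of the equivalence force \<open>h\<close> into the Dirichlet space: one through the
  image of the constant 1, the other through finiteness of the measure.\<close>

lemma nn_integral_lborel_plus:
  fixes F :: "'a::euclidean_space \<Rightarrow> ennreal"
  assumes "F \<in> borel_measurable borel"
  shows "(\<integral>\<^sup>+x. F (c + x) \<partial>lborel) = (\<integral>\<^sup>+x. F x \<partial>lborel)"
proof -
  have "(\<integral>\<^sup>+x. F x \<partial>lborel) = (\<integral>\<^sup>+x. F x \<partial>distr lborel borel ((+) c))"
    by (simp add: lborel_distr_plus)
  also have "\<dots> = (\<integral>\<^sup>+x. F (c + x) \<partial>lborel)"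
    using assms by (subst nn_integral_distr) auto
  finally show ?thesis ..
qed

lemma nn_integral_lborel_uminus:
  fixes F :: "'a::euclidean_space \<Rightarrow> ennreal"
  assumes "F \<in> borel_measurable borel"
  shows "(\<integral>\<^sup>+x. F (- x) \<partial>lborel) = (\<integral>\<^sup>+x. F x \<partial>lborel)"
proof -
  have *: "lborel = distr lborel borel (\<lambda>x::'a. - x)"
    using lborel_affine[of "-1" "0::'a"] by (simp add: density_1)
  have "(\<integral>\<^sup>+x. F x \<partial>lborel) = (\<integral>\<^sup>+x. F x \<partial>distr lborel borel (\<lambda>x::'a. - x))"
    using * by simp
  also have "\<dots> = (\<integral>\<^sup>+x. F (- x) \<partial>lborel)"
    using assms by (subst nn_integral_distr) auto
  finally show ?thesis ..
qed

text \<open>Translation invariance already determines Lebesgue measure up to a factor: integrating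
  \<open>1\<^sub>A(\<omega>x) 1\<^sub>B(y)\<close> in both orders, with \<open>B\<close> the unit ball, yields the invariance under rotations.\<close>

lemma emeasure_lborel_rotation:
  fixes A :: "complex set"
  assumes [measurable]: "A \<in> sets borel" and w: "cmod w = 1"
  shows "emeasure lborel ((*) w -` A) = emeasure lborel A"
proof -
  define B where "B = ball (0::complex) 1"
  have [measurable]: "B \<in> sets borel" by (simp add: B_def)
  have w0: "w \<noteq> 0" using w by auto
  define X where "X = (\<integral>\<^sup>+x. indicator A (w * x) \<partial>lborel)"
  have Bw: "indicator B (w * x) = (indicator B x :: ennreal)" for x
    by (simp add: B_def indicator_def norm_mult w)
  have "X * emeasure lborel B = (\<integral>\<^sup>+x. \<integral>\<^sup>+y. indicator A (w * x) * indicator B y \<partial>lborel \<partial>lborel)"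
    unfolding X_def by (simp add: nn_integral_cmult nn_integral_multc)
  also have "\<dots> = (\<integral>\<^sup>+x. \<integral>\<^sup>+y. indicator A (w * x) * indicator B (w * x + y) \<partial>lborel \<partial>lborel)"
    by (subst nn_integral_lborel_plus) auto
  also have "\<dots> = (\<integral>\<^sup>+y. \<integral>\<^sup>+x. indicator A (w * x) * indicator B (w * x + y) \<partial>lborel \<partial>lborel)"
    by (rule lborel_pair.Fubini') measurable
  \<comment> \<open>For fixed \<open>y\<close>, translating \<open>x\<close> by \<open>y / w\<close>
    replaces \<open>w * x\<close> by \<open>w * x + y\<close>. This moves the shift from
    \<open>B\<close> to \<open>A\<close> without any knowledge of how multiplication by
    \<open>w\<close> acts on the measure.\<close>
  also have "\<dots> = (\<integral>\<^sup>+y. \<integral>\<^sup>+x. indicator A (w * x - y) * indicator B (w * x) \<partial>lborel \<partial>lborel)"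
  proof (rule nn_integral_cong)
    fix y :: complex
    show "(\<integral>\<^sup>+x. indicator A (w * x) * indicator B (w * x + y) \<partial>lborel)
        = (\<integral>\<^sup>+x. indicator A (w * x - y) * indicator B (w * x) \<partial>lborel)"
      using nn_integral_lborel_plus
        [of "\<lambda>x. indicator A (w * x - y) * indicator B (w * x)" "y / w"] w0
      by (simp add: algebra_simps)
  qed
  also have "\<dots> = (\<integral>\<^sup>+x. \<integral>\<^sup>+y. indicator A (w * x - y) * indicator B (w * x) \<partial>lborel \<partial>lborel)"
    by (rule lborel_pair.Fubini') measurable
  also have "\<dots> = (\<integral>\<^sup>+x. emeasure lborel A * indicator B x \<partial>lborel)"
  proof (rule nn_integral_cong)
    fix x :: complex
    have "(\<integral>\<^sup>+y. indicator A (w * x - y) * indicator B (w * x) \<partial>lborel)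
        = (\<integral>\<^sup>+y. indicator A (w * x - y) \<partial>lborel) * indicator B x"
      by (simp add: nn_integral_multc Bw)
    also have "(\<integral>\<^sup>+y. indicator A (w * x - y) \<partial>lborel)
        = (\<integral>\<^sup>+y. indicator A (w * x + y) \<partial>lborel)"
      using nn_integral_lborel_uminus[of "\<lambda>y. indicator A (w * x + y)"] by simp
    also have "\<dots> = emeasure lborel A"
      by (subst nn_integral_lborel_plus) auto
    finally show "(\<integral>\<^sup>+y. indicator A (w * x - y) * indicator B (w * x) \<partial>lborel)
        = emeasure lborel A * indicator B x" .
  qed
  also have "\<dots> = emeasure lborel A * emeasure lborel B"
    by (simp add: nn_integral_cmult)
  finally have "X * emeasure lborel B = emeasure lborel A * emeasure lborel B" .
  moreover have "emeasure lborel B \<noteq> 0" "emeasure lborel B \<noteq> top"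
    by (simp_all add: B_def emeasure_ball unit_ball_vol_2)
  ultimately have "X = emeasure lborel A"
    by (simp add: ennreal_mult_cancel_left mult.commute[of _ "emeasure lborel B"])
  moreover have "X = emeasure lborel ((*) w -` A)"
  proof -
    have "X = (\<integral>\<^sup>+x. indicator ((*) w -` A) x \<partial>lborel)"
      unfolding X_def by (intro nn_integral_cong) (auto simp: indicator_def)
    moreover have "(*) w -` A \<in> sets lborel"
      using measurable_sets[of "(*) w" borel borel A] by auto
    ultimately show ?thesis by (subst (asm) nn_integral_indicator) auto
  qed
  ultimately show ?thesis by simp
qed

lemma space_disc_area [simp]: "space disc_area = unit_disc"
  by (simp add: disc_area_def space_scale_measure space_restrict_space)

lemma sets_disc_area [measurable_cong]: "sets disc_area = sets (restrict_space borel unit_disc)"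
  by (simp add: disc_area_def sets_restrict_space)

lemma nn_integral_disc_area:
  assumes [measurable]: "F \<in> borel_measurable borel"
  shows "(\<integral>\<^sup>+z. F z \<partial>disc_area) = ennreal (1/pi) * (\<integral>\<^sup>+z. F z * indicator unit_disc z \<partial>lborel)"
proof -
  have "F \<in> borel_measurable (restrict_space lborel unit_disc)"
    by (simp add: measurable_restrict_space1)
  then show ?thesis unfolding disc_area_def
    by (subst nn_integral_scale_measure) (auto simp: nn_integral_restrict_space)
qed

lemma emeasure_disc_area:
  assumes "A \<in> sets borel" "A \<subseteq> unit_disc"
  shows "emeasure disc_area A = ennreal (1/pi) * emeasure lborel A"
  using assms by (simp add: disc_area_def emeasure_restrict_space)

lemma measurable_disc_area_rotation:
  assumes w: "cmod w = 1"
  shows "(*) w \<in> measurable disc_area disc_area"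
proof -
  have "(*) w \<in> measurable disc_area borel"
    by (subst measurable_cong_sets[OF sets_disc_area refl]) (auto intro!: measurable_restrict_space1)
  then show ?thesis
    by (subst measurable_cong_sets[OF refl sets_disc_area])
       (auto intro!: measurable_restrict_space2 simp: norm_mult w)
qed

lemma distr_disc_area_rotation:
  assumes w: "cmod w = 1"
  shows "distr disc_area disc_area ((*) w) = disc_area"
proof (rule measure_eqI)
  fix A assume "A \<in> sets (distr disc_area disc_area ((*) w))"
  then have A: "A \<in> sets disc_area" by simp
  then have A2: "A \<subseteq> unit_disc" "A \<in> sets borel"
    by (auto simp: sets_disc_area sets_restrict_space)
  have B: "(*) w -` A \<subseteq> unit_disc" using A2 w by (auto simp: norm_mult)
  have "emeasure (distr disc_area disc_area ((*) w)) A = emeasure disc_area ((*) w -` A)"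
    using B by (subst emeasure_distr[OF measurable_disc_area_rotation[OF w] A]) (simp add: Int_absorb2)
  also have "\<dots> = emeasure disc_area A"
    using A2 B measurable_sets[of "(*) w" borel borel A]
    by (simp add: emeasure_disc_area emeasure_lborel_rotation[OF _ w])
  finally show "emeasure (distr disc_area disc_area ((*) w)) A = emeasure disc_area A" .
qed simp

lemma emeasure_disc_area_ball:
  assumes "0 \<le> r" "r \<le> 1"
  shows "emeasure disc_area (cball 0 r \<inter> unit_disc) = ennreal (r\<^sup>2)"
proof -
  have "emeasure lborel (ball (0::complex) r) = ennreal (pi * r\<^sup>2)"
    "emeasure lborel (cball (0::complex) r) = ennreal (pi * r\<^sup>2)"
    using assms by (simp_all add: emeasure_ball emeasure_cball unit_ball_vol_2)
  \<comment> \<open>For \<open>r < 1\<close> the set is the closed ball, for \<open>r = 1\<close>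
    the open one; squeezing between two balls of equal volume covers both.\<close>
  moreover have "ball 0 r \<subseteq> cball 0 r \<inter> unit_disc" "cball 0 r \<inter> unit_disc \<subseteq> cball (0::complex) r"
    using assms by auto
  ultimately have "emeasure lborel (cball 0 r \<inter> ball (0::complex) 1) = ennreal (pi * r\<^sup>2)"
    by (metis (no_types, lifting) antisym borel_closed borel_open closed_cball emeasure_mono open_ball sets.Int sets_lborel)
  then show ?thesis
    by (subst emeasure_disc_area) (auto simp flip: ennreal_mult' )
qed

lemma prob_disc_area: "emeasure disc_area unit_disc = 1"
  using emeasure_disc_area_ball[of 1] by (simp add: Int_absorb1)

lemma finite_measure_disc_area: "finite_measure disc_area"
  by (rule finite_measureI) (simp add: prob_disc_area)

lemma borel_measurable_disc_area [measurable (raw)]: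
  "f \<in> borel_measurable borel \<Longrightarrow> f \<in> borel_measurable disc_area"
  by (subst measurable_cong_sets[OF sets_disc_area refl]) (rule measurable_restrict_space1)

text \<open>The disc of radius \<open>sqrt x\<close> has normalized area \<open>x\<close>, the
  distribution function of the uniform law on the unit interval. This takes the place of polar
  coordinates.\<close>

lemma distr_disc_area_norm2:
  "distr disc_area borel (\<lambda>z. (cmod z)\<^sup>2) = density lborel (indicator {0..1})"
proof (rule measure_eqI_lessThan)
  interpret finite_measure disc_area by (rule finite_measure_disc_area)
  have m: "(\<lambda>z. (cmod z)\<^sup>2) \<in> borel_measurable disc_area" by measurable
  have L: "emeasure (distr disc_area borel (\<lambda>z. (cmod z)\<^sup>2)) {x<..}
     = (if x < 0 then 1 else if x < 1 then ennreal (1 - x) else 0)" for x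
  proof -
    have "emeasure (distr disc_area borel (\<lambda>z. (cmod z)\<^sup>2)) {x<..}
        = emeasure disc_area {z \<in> unit_disc. x < (cmod z)\<^sup>2}"
      by (subst emeasure_distr[OF m]) (auto intro!: arg_cong[where f="emeasure disc_area"])
    also have "\<dots> = (if x < 0 then 1 else if x < 1 then ennreal (1 - x) else 0)"
    proof -
      consider "x < 0" | "0 \<le> x" "x < 1" | "x \<ge> 1" by linarith
      then show ?thesis
      proof cases
        case 1
        then have "{z \<in> unit_disc. x < (cmod z)\<^sup>2} = unit_disc"
          by (auto intro: less_le_trans)
        then show ?thesis using 1 by (simp add: prob_disc_area)
      next
        case 2
        have "{z \<in> unit_disc. x < (cmod z)\<^sup>2} = unit_disc - (cball 0 (sqrt x) \<inter> unit_disc)"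
          using 2 by (auto simp: not_le real_le_rsqrt) (metis not_le power2_eq_square real_sqrt_le_iff real_sqrt_abs abs_norm_cancel)+
        moreover have "cball 0 (sqrt x) \<inter> unit_disc \<in> sets disc_area"
          by (auto simp: sets_disc_area sets_restrict_space)
        moreover have "emeasure disc_area (unit_disc - (cball 0 (sqrt x) \<inter> unit_disc))
          = 1 - ennreal x"
          using 2 calculation(2) emeasure_disc_area_ball[of "sqrt x"]
          by (subst emeasure_Diff) (auto simp: prob_disc_area sets_disc_area sets_restrict_space)
        ultimately show ?thesis using 2 by (simp flip: ennreal_1 add: ennreal_minus)
      next
        case 3
        have "{z \<in> unit_disc. x < (cmod z)\<^sup>2} = {}"
        proof -
          have "(cmod z)\<^sup>2 < 1" if "cmod z < 1" for z
            using that by (simp add: power_less_one_iff abs_square_less_1)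
          then show ?thesis using 3 by fastforce
        qed
        then show ?thesis using 3 by (simp only:) simp
      qed
    qed
    finally show ?thesis .
  qed
  then show "emeasure (distr disc_area borel (\<lambda>z. (cmod z)\<^sup>2)) {x<..} < \<infinity>" for x by simp
  have R: "emeasure (density lborel (indicator {0..1})) {x<..}
     = (if x < 0 then 1 else if x < 1 then ennreal (1 - x) else 0)" for x :: real
  proof -
    have "emeasure (density lborel (indicator {0..1})) {x<..} = emeasure lborel ({0..1} \<inter> {x<..})"
      by (simp add: emeasure_density flip: indicator_inter_arith)
    also have "{0..1} \<inter> {x<..} = (if x < 0 then {0..1} else {x<..1})" by auto
    finally show ?thesis by auto
  qed
  show "emeasure (distr disc_area borel (\<lambda>z. (cmod z)\<^sup>2)) {x<..}
      = emeasure (density lborel (indicator {0..1})) {x<..}" for x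
    unfolding L R ..
qed auto

text \<open>With \<open>x = |z|^2\<close> this is the integral of \<open>x ^ n\<close> over the unit
  interval; it is the squared Bergman norm of \<open>z ^ n\<close>.\<close>

lemma has_bochner_integral_disc_area_radial:
  "has_bochner_integral disc_area (\<lambda>z. (cmod z) ^ (2*n)) (1 / real (Suc n))"
proof -
  have "((\<lambda>x. x ^ Suc n / Suc n) has_real_derivative x ^ n) (at x)" for x :: real
    by (rule derivative_eq_intros refl | simp del: of_nat_Suc)+
  then have "has_bochner_integral lborel (\<lambda>x::real. x ^ n * indicator {0..1} x)
     (1 ^ (Suc n) / Suc n - 0 ^ (Suc n) / Suc n)"
    by (intro has_bochner_integral_FTC_Icc_nonneg) (auto intro: DERIV_subset simp del: of_nat_Suc)
  then have "has_bochner_integral lborel (\<lambda>x::real. indicator {0..1} x *\<^sub>R x ^ n) (1 / real (Suc n))"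
    by (simp add: mult.commute)
  then have "has_bochner_integral (density lborel (\<lambda>x. ennreal (indicator {0..1} x))) (\<lambda>x::real. x ^ n) (1 / real (Suc n))"
    by (subst has_bochner_integral_density) auto
  then have *: "has_bochner_integral (distr disc_area borel (\<lambda>z. (cmod z)\<^sup>2)) (\<lambda>x::real. x ^ n) (1 / real (Suc n))"
    by (simp add: distr_disc_area_norm2 ennreal_indicator)
  have "has_bochner_integral disc_area (\<lambda>z. ((cmod z)\<^sup>2) ^ n) (1 / real (Suc n))"
    using * integrable_distr_eq[of "\<lambda>z. (cmod z)\<^sup>2" disc_area borel "\<lambda>x::real. x ^ n"]
      integral_distr[of "\<lambda>z. (cmod z)\<^sup>2" disc_area borel "\<lambda>x::real. x ^ n"]
    by (simp add: has_bochner_integral_iff borel_measurable_disc_area)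
  then show ?thesis by (simp add: power_mult)
qed

section \<open>Parseval's identity\<close>

lemma borel_measurable_disc_area_continuous:
  fixes F :: "complex \<Rightarrow> 'b::topological_space"
  assumes "continuous_on unit_disc F"
  shows "F \<in> borel_measurable disc_area"
  using assms by (subst measurable_cong_sets[OF sets_disc_area refl])
    (rule borel_measurable_continuous_on_restrict)

lemma integrable_disc_area_continuous:
  fixes F :: "complex \<Rightarrow> 'b::{banach, second_countable_topology}"
  assumes "continuous_on (cball 0 1) F"
  shows "integrable disc_area F"
proof -
  interpret finite_measure disc_area by (rule finite_measure_disc_area)
  have "compact (F ` cball 0 1)"
    using assms by (intro compact_continuous_image) auto
  then obtain B where B: "\<And>z. z \<in> cball 0 1 \<Longrightarrow> norm (F z) \<le> B"
    by (meson bounded_iff compact_imp_bounded imageI)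
  have "F \<in> borel_measurable disc_area"
    by (rule borel_measurable_disc_area_continuous) (auto intro: continuous_on_subset[OF assms])
  then show ?thesis
    using B by (intro integrable_const_bound[of _ B]) (auto intro!: AE_I2)
qed

lemma integral_disc_area_rotation:
  fixes F :: "complex \<Rightarrow> 'b::{banach, second_countable_topology}"
  assumes "F \<in> borel_measurable disc_area" "cmod w = 1"
  shows "(\<integral>z. F (w * z) \<partial>disc_area) = (\<integral>z. F z \<partial>disc_area)"
proof -
  have "(\<integral>z. F z \<partial>distr disc_area disc_area ((*) w)) = (\<integral>z. F (w * z) \<partial>disc_area)"
    using measurable_disc_area_rotation[OF assms(2)] assms(1) by (rule integral_distr)
  then show ?thesis by (simp add: distr_disc_area_rotation[OF assms(2)])
qed

lemma integral_disc_area_homogeneous_eq_0: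
  fixes F :: "complex \<Rightarrow> complex"
  assumes F: "F \<in> borel_measurable disc_area"
    and hom: "\<And>t z. F (cis t * z) = cis (of_int j * t) * F z" and j: "j \<noteq> 0"
  shows "(\<integral>z. F z \<partial>disc_area) = 0"
proof -
  \<comment> \<open>Rotation by \<open>pi / j\<close> multiplies \<open>F\<close> by
    \<open>cis pi = -1\<close> and preserves the measure, so the integral is its own
    negative.\<close>
  define t where "t = pi / of_int j"
  have "cis (of_int j * t) = -1" using j by (simp add: t_def)
  then have "F (cis t * z) = - F z" for z
    by (simp add: hom)
  then have "(\<integral>z. F z \<partial>disc_area) = - (\<integral>z. F z \<partial>disc_area)"
    using integral_disc_area_rotation[OF F, of "cis t"] by simp
  then show ?thesis by simp
qed

text \<open>Functions of different degree under rotation are orthogonal, so Pythagoras applies.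
  Degrees are integers because the lemma serves monomials and also the functions
  \<open>antiproj k m\<close>, whose degree \<open>m - k\<close> may be negative.\<close>

lemma integral_disc_area_norm2_sum_orthogonal:
  fixes \<phi> :: "'i \<Rightarrow> complex \<Rightarrow> complex" and d :: "'i \<Rightarrow> int"
  assumes I: "finite I" and d: "inj_on d I"
    and cont: "\<And>i. i \<in> I \<Longrightarrow> continuous_on UNIV (\<phi> i)"
    and hom: "\<And>i t z. i \<in> I \<Longrightarrow> \<phi> i (cis t * z) = cis (of_int (d i) * t) * \<phi> i z"
  shows "(\<integral>z. (cmod (\<Sum>i\<in>I. a i * \<phi> i z))\<^sup>2 \<partial>disc_area)
    = (\<Sum>i\<in>I. (cmod (a i))\<^sup>2 * (\<integral>z. (cmod (\<phi> i z))\<^sup>2 \<partial>disc_area))"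
proof -
  have int: "integrable disc_area (\<lambda>z. \<phi> i z * cnj (\<phi> j z))" if "i \<in> I" "j \<in> I" for i j
    using that cont by (intro integrable_disc_area_continuous continuous_intros)
      (auto intro: continuous_on_subset)
  have 0: "(\<integral>z. \<phi> i z * cnj (\<phi> j z) \<partial>disc_area) = 0" if ij: "i \<in> I" "j \<in> I" "i \<noteq> j" for i j
  proof (rule integral_disc_area_homogeneous_eq_0[where j = "d i - d j"])
    show "(\<lambda>z. \<phi> i z * cnj (\<phi> j z)) \<in> borel_measurable disc_area"
      using int ij by auto
    show "d i - d j \<noteq> 0" using d ij by (auto simp: inj_on_def)
    fix t z
    have "cis (of_int (d i - d j) * t) = cis (of_int (d i) * t) * cnj (cis (of_int (d j) * t))"
      by (simp add: cis_cnj cis_mult algebra_simps)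
    then show "\<phi> i (cis t * z) * cnj (\<phi> j (cis t * z))
        = cis (of_int (d i - d j) * t) * (\<phi> i z * cnj (\<phi> j z))"
      using ij by (simp add: hom)
  qed
  have "of_real (\<integral>z. (cmod (\<Sum>i\<in>I. a i * \<phi> i z))\<^sup>2 \<partial>disc_area)
     = (\<integral>z. (\<Sum>i\<in>I. \<Sum>j\<in>I. (a i * cnj (a j)) * (\<phi> i z * cnj (\<phi> j z))) \<partial>disc_area)"
    unfolding integral_complex_of_real[symmetric]
    by (intro Bochner_Integration.integral_cong)
       (auto simp: complex_norm_square sum_product cnj_sum mult_ac simp del: of_real_power)
  also have "\<dots> = (\<Sum>i\<in>I. \<Sum>j\<in>I. (a i * cnj (a j)) * (\<integral>z. \<phi> i z * cnj (\<phi> j z) \<partial>disc_area))"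
    by (subst Bochner_Integration.integral_sum;
        (intro Bochner_Integration.integrable_sum integrable_mult_right int sum.cong refl)?;
        (subst Bochner_Integration.integral_sum)?;
        (intro Bochner_Integration.integrable_sum integrable_mult_right int sum.cong refl)?; simp)
  also have "\<dots> = (\<Sum>i\<in>I. (a i * cnj (a i)) * (\<integral>z. \<phi> i z * cnj (\<phi> i z) \<partial>disc_area))"
  proof (rule sum.cong[OF refl])
    fix i assume i: "i \<in> I"
    have "(\<Sum>j\<in>I. (a i * cnj (a j)) * (\<integral>z. \<phi> i z * cnj (\<phi> j z) \<partial>disc_area))
      = (\<Sum>j\<in>I. if j = i then (a i * cnj (a i)) * (\<integral>z. \<phi> i z * cnj (\<phi> i z) \<partial>disc_area) else 0)"
      using 0 i by (intro sum.cong) auto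
    then show "(\<Sum>j\<in>I. (a i * cnj (a j)) * (\<integral>z. \<phi> i z * cnj (\<phi> j z) \<partial>disc_area))
      = (a i * cnj (a i)) * (\<integral>z. \<phi> i z * cnj (\<phi> i z) \<partial>disc_area)"
      using i I by simp
  qed
  also have "\<dots> = of_real (\<Sum>i\<in>I. (cmod (a i))\<^sup>2 * (\<integral>z. (cmod (\<phi> i z))\<^sup>2 \<partial>disc_area))"
    by (simp add: complex_norm_square[symmetric] flip: integral_complex_of_real of_real_power)
  finally show ?thesis by (simp only: of_real_eq_iff)
qed

lemma integral_disc_area_norm2_polynomial:
  "(\<integral>z. (cmod (\<Sum>n<N. a n * z ^ n))\<^sup>2 \<partial>disc_area) = (\<Sum>n<N. (cmod (a n))\<^sup>2 / real (Suc n))"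
proof -
  have "(\<integral>z. (cmod (z ^ n))\<^sup>2 \<partial>disc_area) = 1 / real (Suc n)" for n
    using has_bochner_integral_disc_area_radial[of n]
    by (simp add: has_bochner_integral_iff norm_power power_mult mult.commute)
  moreover have "(\<integral>z. (cmod (\<Sum>n<N. a n * z ^ n))\<^sup>2 \<partial>disc_area)
      = (\<Sum>n<N. (cmod (a n))\<^sup>2 * (\<integral>z. (cmod (z ^ n))\<^sup>2 \<partial>disc_area))"
    by (rule integral_disc_area_norm2_sum_orthogonal[where d = int])
       (auto intro!: continuous_intros simp: power_mult_distrib Complex.DeMoivre)
  ultimately show ?thesis by simp
qed

text \<open>Ties a function to a coefficient sequence, so that sums, products with monomials and
  derivatives can be followed on coefficients. Only values on the open disc are constrained.\<close>

definition disc_series :: "(complex \<Rightarrow> complex) \<Rightarrow> (nat \<Rightarrow> complex) \<Rightarrow> bool" where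
  "disc_series f a \<longleftrightarrow> (\<forall>z\<in>unit_disc. (\<lambda>n. a n * z ^ n) sums f z)"

lemma disc_series_holomorphic:
  assumes "disc_series f a"
  shows "f holomorphic_on unit_disc"
  using assms unfolding disc_series_def
  by (intro power_series_holomorphic[where a = a]) auto

lemma disc_series_abs_summable:
  assumes f: "disc_series f a" and r: "0 \<le> r" "r < 1"
  shows "summable (\<lambda>n. cmod (a n) * r ^ n)"
proof -
  obtain s where s: "r < s" "s < 1" using r dense by blast
  have "summable (\<lambda>n. a n * (of_real s) ^ n)"
    using f s r unfolding disc_series_def by (auto dest!: bspec[of _ _ "of_real s"] simp: sums_iff)
  from powser_insidea[OF this, of "of_real r"] show ?thesis
    using s r by (simp add: norm_mult norm_power)
qed

lemma nn_integral_lborel_scale: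
  fixes F :: "complex \<Rightarrow> ennreal"
  assumes [measurable]: "F \<in> borel_measurable borel" and r: "r > 0"
  shows "(\<integral>\<^sup>+z. F z \<partial>lborel) = ennreal (r\<^sup>2) * (\<integral>\<^sup>+z. F (of_real r * z) \<partial>lborel)"
proof -
  have "lborel = density (distr lborel borel (\<lambda>x::complex. r *\<^sub>R x)) (\<lambda>_. ennreal (r\<^sup>2))"
    using lborel_affine[of r "0::complex"] r by simp
  then have "(\<integral>\<^sup>+z. F z \<partial>lborel)
      = (\<integral>\<^sup>+z. F z \<partial>density (distr lborel borel (\<lambda>x::complex. r *\<^sub>R x)) (\<lambda>_. ennreal (r\<^sup>2)))"
    by (rule arg_cong)
  also have "\<dots> = ennreal (r\<^sup>2) * (\<integral>\<^sup>+z. F (of_real r * z) \<partial>lborel)"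
    by (subst nn_integral_density) (auto simp: nn_integral_distr nn_integral_cmult scaleR_conv_of_real)
  finally show ?thesis .
qed

text \<open>After the substitution, with Jacobian \<open>r^2\<close>, the left side is the integral
  of \<open>F\<close> over the disc of radius \<open>r\<close>. The proof enlarges the domain to the
  plane, over which \<open>G\<close>, the extension of \<open>F\<close> by zero, has the integral of
  \<open>F\<close>.\<close>

lemma nn_integral_disc_area_dilate:
  fixes F :: "complex \<Rightarrow> ennreal"
  assumes F: "F \<in> borel_measurable disc_area" and r: "0 < r" "r \<le> 1"
  shows "ennreal (r\<^sup>2) * (\<integral>\<^sup>+z. F (of_real r * z) \<partial>disc_area) \<le> (\<integral>\<^sup>+z. F z \<partial>disc_area)"
proof -
  define G where "G z = F z * indicator unit_disc z" for z
  have [measurable]: "G \<in> borel_measurable borel"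
  proof -
    have "F \<in> borel_measurable (restrict_space borel unit_disc)"
      using F by (subst (asm) measurable_cong_sets[OF sets_disc_area refl])
    then show ?thesis unfolding G_def
      by (subst (asm) borel_measurable_restrict_space_iff_ennreal) auto
  qed
  have D: "of_real r * z \<in> unit_disc" if "z \<in> unit_disc" for z
    using that r by (simp add: norm_mult) (meson le_less_trans mult_left_le_one_le norm_ge_zero less_imp_le)
  have "(\<integral>\<^sup>+z. F (of_real r * z) \<partial>disc_area) = (\<integral>\<^sup>+z. G (of_real r * z) \<partial>disc_area)"
    using D by (intro nn_integral_cong) (simp add: G_def)
  also have "\<dots> = ennreal (1/pi) * (\<integral>\<^sup>+z. G (of_real r * z) * indicator unit_disc z \<partial>lborel)"
    by (rule nn_integral_disc_area) simp
  also have "\<dots> \<le> ennreal (1/pi) * (\<integral>\<^sup>+z. G (of_real r * z) \<partial>lborel)"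
    by (intro mult_left_mono nn_integral_mono) (auto simp: indicator_def)
  finally have "ennreal (r\<^sup>2) * (\<integral>\<^sup>+z. F (of_real r * z) \<partial>disc_area)
      \<le> ennreal (1/pi) * (ennreal (r\<^sup>2) * (\<integral>\<^sup>+z. G (of_real r * z) \<partial>lborel))"
    by (metis mult.left_commute mult_left_mono zero_le)
  also have "\<dots> = ennreal (1/pi) * (\<integral>\<^sup>+z. G z * indicator unit_disc z \<partial>lborel)"
    by (subst nn_integral_lborel_scale[OF _ r(1), symmetric]) (auto simp: G_def indicator_def intro!: arg_cong2[where f="(*)"] nn_integral_cong)
  also have "\<dots> = (\<integral>\<^sup>+z. G z \<partial>disc_area)"
    by (rule nn_integral_disc_area[symmetric]) simp
  also have "\<dots> = (\<integral>\<^sup>+z. F z \<partial>disc_area)"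
    by (intro nn_integral_cong) (simp add: G_def)
  finally show ?thesis .
qed

text \<open>For \<open>r < 1\<close> the partial sums are bounded on the disc by the constant
  \<open>B\<close>, which is integrable as the measure is finite; dominated convergence carries the
  polynomial case to the limit.\<close>

lemma disc_series_dilate_parseval:
  assumes f: "disc_series f a" and r: "0 < r" "r < 1"
  shows "integrable disc_area (\<lambda>z. (cmod (f (of_real r * z)))\<^sup>2)"
    and "(\<lambda>n. (cmod (a n))\<^sup>2 * r ^ (2 * n) / real (Suc n)) sums (\<integral>z. (cmod (f (of_real r * z)))\<^sup>2 \<partial>disc_area)"
proof -
  interpret finite_measure disc_area by (rule finite_measure_disc_area)
  define S where "S N z = (\<Sum>n<N. (a n * of_real (r ^ n)) * z ^ n)" for N :: nat and z :: complex
  define B where "B = (\<Sum>n. cmod (a n) * r ^ n)"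
  have summ: "summable (\<lambda>n. cmod (a n) * r ^ n)"
    using disc_series_abs_summable[OF f] r by simp
  have lim: "(\<lambda>N. (cmod (S N z))\<^sup>2) \<longlonglongrightarrow> (cmod (f (of_real r * z)))\<^sup>2" if "z \<in> unit_disc" for z
  proof -
    have "of_real r * z \<in> unit_disc"
      using that r by (simp add: norm_mult) (meson le_less_trans mult_left_le_one_le norm_ge_zero less_imp_le)
    then have "(\<lambda>n. a n * (of_real r * z) ^ n) sums f (of_real r * z)"
      using f by (auto simp: disc_series_def)
    then have "(\<lambda>N. S N z) \<longlonglongrightarrow> f (of_real r * z)"
      unfolding sums_def S_def by (simp add: power_mult_distrib mult_ac)
    then show ?thesis by (intro tendsto_intros)
  qed
  have bound: "cmod (S N z) \<le> B" if "z \<in> unit_disc" for N z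
  proof -
    have "cmod (S N z) \<le> (\<Sum>n<N. cmod (a n) * r ^ n)"
      unfolding S_def
    proof (rule sum_norm_le)
      fix n
      have "cmod z ^ n \<le> 1" using that by (simp add: power_le_one)
      then show "norm ((a n * of_real (r ^ n)) * z ^ n) \<le> cmod (a n) * r ^ n"
        using r by (simp add: norm_mult norm_power mult_left_le)
    qed
    also have "\<dots> \<le> B" unfolding B_def
      using r by (intro sum_le_suminf summ) auto
    finally show ?thesis .
  qed
  have meas: "(\<lambda>z. (cmod (S N z))\<^sup>2) \<in> borel_measurable disc_area" for N
    unfolding S_def by (intro borel_measurable_disc_area) measurable
  have meas2: "(\<lambda>z. (cmod (f (of_real r * z)))\<^sup>2) \<in> borel_measurable disc_area"
    using lim by (intro borel_measurable_LIMSEQ_metric[OF meas]) auto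
  have bd: "norm ((cmod (S N z))\<^sup>2) \<le> B\<^sup>2" if "z \<in> unit_disc" for N z
    using power_mono[OF bound[OF that, of N], of 2] by simp
  have intB: "integrable disc_area (\<lambda>z. B\<^sup>2)" by simp
  show "integrable disc_area (\<lambda>z. (cmod (f (of_real r * z)))\<^sup>2)"
    by (rule integrable_dominated_convergence[OF meas2 meas intB]) (use lim bd in \<open>auto intro!: AE_I2\<close>)
  have "(\<lambda>N. \<integral>z. (cmod (S N z))\<^sup>2 \<partial>disc_area) \<longlonglongrightarrow> (\<integral>z. (cmod (f (of_real r * z)))\<^sup>2 \<partial>disc_area)"
    by (rule integral_dominated_convergence[OF meas2 meas intB]) (use lim bd in \<open>auto intro!: AE_I2\<close>)
  then show "(\<lambda>n. (cmod (a n))\<^sup>2 * r ^ (2 * n) / real (Suc n)) sums (\<integral>z. (cmod (f (of_real r * z)))\<^sup>2 \<partial>disc_area)"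
    unfolding sums_def S_def integral_disc_area_norm2_polynomial using r
    by (simp add: norm_mult norm_power power_mult_distrib power_mult[symmetric] mult.commute)
qed

text \<open>Values in \<open>[0, \<infinity>]\<close> let the identity also decide membership in the
  Bergman space. Fatou's lemma for the partial sums gives one inequality; the other goes through the
  dilates of \<open>f\<close>, for which Parseval holds outright.\<close>

theorem disc_series_parseval:
  assumes f: "disc_series f a"
  shows "(\<integral>\<^sup>+z. ennreal ((cmod (f z))\<^sup>2) \<partial>disc_area) = (\<Sum>n. ennreal ((cmod (a n))\<^sup>2 / real (Suc n)))"
proof (rule antisym)
  have cont: "continuous_on unit_disc f"
    using disc_series_holomorphic[OF f] by (rule holomorphic_on_imp_continuous_on)
  have meas: "(\<lambda>z. ennreal ((cmod (f z))\<^sup>2)) \<in> borel_measurable disc_area"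
    using borel_measurable_disc_area_continuous[OF cont] by measurable
  define S where "S N z = (\<Sum>n<N. a n * z ^ n)" for N :: nat and z :: complex
  have int: "integrable disc_area (\<lambda>z. (cmod (S N z))\<^sup>2)" for N
    unfolding S_def by (intro integrable_disc_area_continuous continuous_intros)
  have eq: "(\<integral>\<^sup>+z. ennreal ((cmod (S N z))\<^sup>2) \<partial>disc_area) = (\<Sum>n<N. ennreal ((cmod (a n))\<^sup>2 / real (Suc n)))" for N
    using int[of N] integral_disc_area_norm2_polynomial[of a N]
    by (subst nn_integral_eq_integral) (auto simp: S_def sum_nonneg)
  have "(\<integral>\<^sup>+z. ennreal ((cmod (f z))\<^sup>2) \<partial>disc_area)
      = (\<integral>\<^sup>+z. liminf (\<lambda>N. ennreal ((cmod (S N z))\<^sup>2)) \<partial>disc_area)"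
  proof (rule nn_integral_cong)
    fix z assume "z \<in> space disc_area"
    then have "(\<lambda>N. S N z) \<longlonglongrightarrow> f z"
      using f by (auto simp: disc_series_def sums_def S_def)
    then have "(\<lambda>N. ennreal ((cmod (S N z))\<^sup>2)) \<longlonglongrightarrow> ennreal ((cmod (f z))\<^sup>2)"
      by (intro tendsto_ennrealI tendsto_intros)
    from lim_imp_Liminf[OF _ this] show "ennreal ((cmod (f z))\<^sup>2) = liminf (\<lambda>N. ennreal ((cmod (S N z))\<^sup>2))"
      by simp
  qed
  also have "\<dots> \<le> liminf (\<lambda>N. \<integral>\<^sup>+z. ennreal ((cmod (S N z))\<^sup>2) \<partial>disc_area)"
    by (rule nn_integral_liminf) (use int in measurable)
  also have "\<dots> = (\<Sum>n. ennreal ((cmod (a n))\<^sup>2 / real (Suc n)))"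
    unfolding eq by (intro lim_imp_Liminf summable_LIMSEQ) auto
  finally show "(\<integral>\<^sup>+z. ennreal ((cmod (f z))\<^sup>2) \<partial>disc_area) \<le> (\<Sum>n. ennreal ((cmod (a n))\<^sup>2 / real (Suc n)))" .
  show "(\<Sum>n. ennreal ((cmod (a n))\<^sup>2 / real (Suc n))) \<le> (\<integral>\<^sup>+z. ennreal ((cmod (f z))\<^sup>2) \<partial>disc_area)"
  proof (cases "(\<integral>\<^sup>+z. ennreal ((cmod (f z))\<^sup>2) \<partial>disc_area)")
    case (real x)
    have le: "r\<^sup>2 * (\<Sum>n<N. (cmod (a n))\<^sup>2 * r ^ (2 * n) / real (Suc n)) \<le> x" if r: "0 < r" "r < 1" for r N
    proof -
      let ?I = "\<integral>z. (cmod (f (of_real r * z)))\<^sup>2 \<partial>disc_area"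
      have "(\<Sum>n<N. (cmod (a n))\<^sup>2 * r ^ (2 * n) / real (Suc n)) \<le> ?I"
        using disc_series_dilate_parseval(2)[OF f r] r
        by (simp only: sums_iff) (metis (no_types, lifting) sum_le_suminf finite_lessThan zero_le_divide_iff
            zero_le_mult_iff zero_le_power2 zero_le_power less_imp_le of_nat_0_le_iff add_nonneg_nonneg zero_le_one)
      moreover have "ennreal (r\<^sup>2 * ?I) \<le> ennreal x"
        using nn_integral_disc_area_dilate[OF meas, of r] r real
          nn_integral_eq_integral[OF disc_series_dilate_parseval(1)[OF f r]]
        by (simp add: ennreal_mult')
      then have "r\<^sup>2 * ?I \<le> x" using real by simp
      ultimately show ?thesis
        by (meson mult_left_mono order_trans zero_le_power2)
    qed
    \<comment> \<open>A finite sum is continuous in \<open>r\<close>, so \<open>N\<close> is kept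
      fixed while \<open>r\<close> tends to 1 from below.\<close>
    have "(\<Sum>n<N. (cmod (a n))\<^sup>2 / real (Suc n)) \<le> x" for N
    proof (rule tendsto_upperbound)
      show "((\<lambda>r. r\<^sup>2 * (\<Sum>n<N. (cmod (a n))\<^sup>2 * r ^ (2 * n) / real (Suc n)))
          \<longlongrightarrow> (\<Sum>n<N. (cmod (a n))\<^sup>2 / real (Suc n))) (at_left 1)"
        by (auto intro!: tendsto_eq_intros)
      show "\<forall>\<^sub>F r in at_left 1. r\<^sup>2 * (\<Sum>n<N. (cmod (a n))\<^sup>2 * r ^ (2 * n) / real (Suc n)) \<le> x"
        by (rule eventually_mono[OF eventually_at_left_real[of 0 "1::real"]]) (use le in auto)
    qed auto
    then have "(\<Sum>n<N. ennreal ((cmod (a n))\<^sup>2 / real (Suc n))) \<le> ennreal x" for N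
      using real by (subst sum_ennreal) (auto intro!: ennreal_leI)
    then show ?thesis using real by (auto intro: suminf_le_const)
  qed auto
qed

section \<open>The Bergman projection of a product\<close>

lemma disc_series_continuous: "disc_series f a \<Longrightarrow> continuous_on unit_disc f"
  by (intro holomorphic_on_imp_continuous_on disc_series_holomorphic)

lemma disc_series_measurable: "disc_series f a \<Longrightarrow> f \<in> borel_measurable disc_area"
  by (intro borel_measurable_disc_area_continuous disc_series_continuous)

lemma disc_series_A2_iff:
  assumes f: "disc_series f a"
  shows "integrable disc_area (\<lambda>z. (cmod (f z))\<^sup>2) \<longleftrightarrow> summable (\<lambda>n. (cmod (a n))\<^sup>2 / real (Suc n))"
proof -
  note disc_series_measurable[OF f, measurable]
  have "integrable disc_area (\<lambda>z. (cmod (f z))\<^sup>2) \<longleftrightarrow> (\<integral>\<^sup>+z. ennreal ((cmod (f z))\<^sup>2) \<partial>disc_area) < \<infinity>"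
    by (subst integrable_iff_bounded) auto
  also have "\<dots> \<longleftrightarrow> (\<Sum>n. ennreal ((cmod (a n))\<^sup>2 / real (Suc n))) < top"
    by (simp add: disc_series_parseval[OF f] del: of_nat_Suc)
  also have "\<dots> \<longleftrightarrow> summable (\<lambda>n. (cmod (a n))\<^sup>2 / real (Suc n))"
    by (auto intro!: summable_suminf_not_top simp: less_top suminf_ennreal2 simp del: of_nat_Suc)
  finally show ?thesis .
qed

lemma disc_series_A2_sums:
  assumes f: "disc_series f a" and "summable (\<lambda>n. (cmod (a n))\<^sup>2 / real (Suc n))"
  shows "(\<integral>z. (cmod (f z))\<^sup>2 \<partial>disc_area) = (\<Sum>n. (cmod (a n))\<^sup>2 / real (Suc n))"
proof -
  have "ennreal (\<integral>z. (cmod (f z))\<^sup>2 \<partial>disc_area) = (\<integral>\<^sup>+z. ennreal ((cmod (f z))\<^sup>2) \<partial>disc_area)"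
    using assms disc_series_A2_iff[OF f] by (subst nn_integral_eq_integral) auto
  also have "\<dots> = ennreal (\<Sum>n. (cmod (a n))\<^sup>2 / real (Suc n))"
    using assms by (subst disc_series_parseval[OF f], intro suminf_ennreal2) auto
  finally show ?thesis
    using assms by (subst (asm) ennreal_inj) (auto intro!: suminf_nonneg)
qed

lemma disc_series_add:
  assumes "disc_series f a" "disc_series g b"
  shows "disc_series (\<lambda>z. f z + g z) (\<lambda>n. a n + b n)"
  using assms unfolding disc_series_def by (auto simp: distrib_right intro!: sums_add)

lemma disc_series_diff:
  assumes "disc_series f a" "disc_series g b"
  shows "disc_series (\<lambda>z. f z - g z) (\<lambda>n. a n - b n)"
  using assms unfolding disc_series_def by (auto simp: left_diff_distrib intro!: sums_diff)

lemma disc_series_cmult: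
  assumes "disc_series f a"
  shows "disc_series (\<lambda>z. c * f z) (\<lambda>n. c * a n)"
  using assms unfolding disc_series_def by (auto simp: mult.assoc intro!: sums_mult)

lemma disc_series_monomial_mult:
  assumes "disc_series f a"
  shows "disc_series (\<lambda>z. z ^ n * f z) (\<lambda>m. if m < n then 0 else a (m - n))"
  unfolding disc_series_def
proof
  fix z assume "z \<in> unit_disc"
  then have "(\<lambda>k. a k * z ^ k) sums f z" using assms by (auto simp: disc_series_def)
  then have "(\<lambda>k. z ^ n * (a k * z ^ k)) sums (z ^ n * f z)" by (rule sums_mult)
  then have "(\<lambda>k. (if k + n < n then 0 else a (k + n - n)) * z ^ (k + n)) sums (z ^ n * f z)"
    by (simp add: power_add mult_ac)
  then show "(\<lambda>m. (if m < n then 0 else a (m - n)) * z ^ m) sums (z ^ n * f z)"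
    using sums_iff_shift[of "\<lambda>m. (if m < n then 0 else a (m - n)) * z ^ m" n "z ^ n * f z"] by simp
qed

lemma disc_series_taylor:
  assumes "f holomorphic_on unit_disc"
  shows "disc_series f (taylor_coeff f)"
  using holomorphic_power_series[OF assms] unfolding disc_series_def taylor_coeff_def by simp

lemma disc_series_zero_unique:
  assumes d: "disc_series (\<lambda>z. 0) d"
  shows "d n = 0"
proof -
  have "(\<Sum>n. ennreal ((cmod (d n))\<^sup>2 / real (Suc n))) = 0"
    by (subst disc_series_parseval[OF d, symmetric]) simp
  then have "ennreal ((cmod (d n))\<^sup>2 / real (Suc n)) = 0"
    by (simp add: suminf_eq_zero_iff del: of_nat_Suc)
  moreover have "(cmod (d n))\<^sup>2 / real (Suc n) \<ge> 0" by simp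
  ultimately show ?thesis by (simp add: ennreal_eq_0_iff del: of_nat_Suc)
qed

lemma disc_series_unique:
  assumes "disc_series f a" "disc_series f b"
  shows "a = b"
proof
  fix n
  show "a n = b n"
    using disc_series_zero_unique[of "\<lambda>n. a n - b n" n] disc_series_diff[OF assms] by simp
qed

lemma disc_series_taylor_coeff:
  assumes "disc_series f a"
  shows "taylor_coeff f = a"
  using disc_series_taylor[OF disc_series_holomorphic[OF assms]] assms by (rule disc_series_unique)

text \<open>Termwise differentiation is avoided: \<open>deriv f\<close> is holomorphic, hence the
  sum of its own Taylor series, whose coefficients are shifted higher derivatives of
  \<open>f\<close> at 0.\<close>

lemma disc_series_deriv:
  assumes "disc_series f a"
  shows "disc_series (deriv f) (\<lambda>n. of_nat (Suc n) * a (Suc n))"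
proof -
  have "deriv f holomorphic_on unit_disc"
    using disc_series_holomorphic[OF assms] by (intro holomorphic_deriv) auto
  then have "disc_series (deriv f) (taylor_coeff (deriv f))"
    by (rule disc_series_taylor)
  moreover have "taylor_coeff (deriv f) = (\<lambda>n. of_nat (Suc n) * taylor_coeff f (Suc n))"
    by (rule ext) (simp add: taylor_coeff_def funpow_Suc_right del: funpow.simps of_nat_Suc)
  ultimately show ?thesis
    using disc_series_taylor_coeff[OF assms] by (simp del: of_nat_Suc)
qed

lemma summable_norm2_add:
  fixes a b :: "nat \<Rightarrow> 'a::real_normed_vector" and w :: "nat \<Rightarrow> real"
  assumes "summable (\<lambda>n. (norm (a n))\<^sup>2 * w n)" "summable (\<lambda>n. (norm (b n))\<^sup>2 * w n)" "\<And>n. w n \<ge> 0"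
  shows "summable (\<lambda>n. (norm (a n + b n))\<^sup>2 * w n)"
proof (rule summable_comparison_test')
  show "summable (\<lambda>n. 2 * ((norm (a n))\<^sup>2 * w n) + 2 * ((norm (b n))\<^sup>2 * w n))"
    by (intro summable_add summable_mult assms)
  fix n
  have "(norm (a n + b n))\<^sup>2 \<le> (norm (a n) + norm (b n))\<^sup>2"
    by (intro power_mono norm_triangle_ineq norm_ge_zero)
  also have "\<dots> \<le> 2 * (norm (a n))\<^sup>2 + 2 * (norm (b n))\<^sup>2"
    using sum_squares_bound[of "norm (a n)" "norm (b n)"] by (simp add: power2_sum)
  finally have "(norm (a n + b n))\<^sup>2 * w n \<le> (2 * (norm (a n))\<^sup>2 + 2 * (norm (b n))\<^sup>2) * w n"
    using assms(3) by (rule mult_right_mono)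
  then show "norm ((norm (a n + b n))\<^sup>2 * w n) \<le> 2 * ((norm (a n))\<^sup>2 * w n) + 2 * ((norm (b n))\<^sup>2 * w n)"
    using assms(3) by (simp add: algebra_simps)
qed

lemma Re_mult_cnj_polarization:
  "Re (x * cnj y) = ((cmod (x + y))\<^sup>2 - (cmod (x - y))\<^sup>2) / 4"
  unfolding cmod_power2 by (simp add: power2_eq_square algebra_simps)

text \<open>Polarization of Parseval's identity. Real parts are enough, since the pairings evaluated
  with it turn out to be real.\<close>

lemma disc_series_inner_product:
  assumes f: "disc_series f a" "summable (\<lambda>n. (cmod (a n))\<^sup>2 / real (Suc n))"
    and g: "disc_series g b" "summable (\<lambda>n. (cmod (b n))\<^sup>2 / real (Suc n))"
  shows "integrable disc_area (\<lambda>z. Re (f z * cnj (g z)))"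
    and "(\<lambda>n. Re (a n * cnj (b n)) / real (Suc n)) sums (\<integral>z. Re (f z * cnj (g z)) \<partial>disc_area)"
proof -
  have s1: "summable (\<lambda>n. (cmod (a n + b n))\<^sup>2 / real (Suc n))"
    using summable_norm2_add[of a "\<lambda>n. 1 / real (Suc n)" b] f(2) g(2) by simp
  have s2: "summable (\<lambda>n. (cmod (a n - b n))\<^sup>2 / real (Suc n))"
    using summable_norm2_add[of a "\<lambda>n. 1 / real (Suc n)" "\<lambda>n. - b n"] f(2) g(2) by simp
  note d1 = disc_series_add[OF f(1) g(1)] and d2 = disc_series_diff[OF f(1) g(1)]
  have i: "integrable disc_area (\<lambda>z. (cmod (f z + g z))\<^sup>2)" "integrable disc_area (\<lambda>z. (cmod (f z - g z))\<^sup>2)"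
    using disc_series_A2_iff[OF d1] s1 disc_series_A2_iff[OF d2] s2 by auto
  show "integrable disc_area (\<lambda>z. Re (f z * cnj (g z)))"
    unfolding Re_mult_cnj_polarization using i by simp
  have "(\<integral>z. Re (f z * cnj (g z)) \<partial>disc_area)
    = ((\<integral>z. (cmod (f z + g z))\<^sup>2 \<partial>disc_area) - (\<integral>z. (cmod (f z - g z))\<^sup>2 \<partial>disc_area)) / 4"
    unfolding Re_mult_cnj_polarization using i by simp
  also have "\<dots> = ((\<Sum>n. (cmod (a n + b n))\<^sup>2 / real (Suc n)) - (\<Sum>n. (cmod (a n - b n))\<^sup>2 / real (Suc n))) / 4"
    by (simp only: disc_series_A2_sums[OF d1 s1] disc_series_A2_sums[OF d2 s2])
  moreover have "(\<lambda>n. ((cmod (a n + b n))\<^sup>2 / real (Suc n) - (cmod (a n - b n))\<^sup>2 / real (Suc n)) / 4)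
    sums (((\<Sum>n. (cmod (a n + b n))\<^sup>2 / real (Suc n)) - (\<Sum>n. (cmod (a n - b n))\<^sup>2 / real (Suc n))) / 4)"
    by (intro sums_divide sums_diff summable_sums s1 s2)
  ultimately show "(\<lambda>n. Re (a n * cnj (b n)) / real (Suc n)) sums (\<integral>z. Re (f z * cnj (g z)) \<partial>disc_area)"
    by (simp only: Re_mult_cnj_polarization diff_divide_distrib divide_divide_eq_left mult.commute)
qed

text \<open>The Taylor coefficients of the Bergman projection of \<open>cnj f * g\<close>, where \<open>f\<close> and \<open>g\<close> have the
  coefficients \<open>a\<close> and \<open>b\<close>.\<close>

definition bergman_coeff :: "(nat \<Rightarrow> complex) \<Rightarrow> (nat \<Rightarrow> complex) \<Rightarrow> nat \<Rightarrow> complex" where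
  "bergman_coeff a b n = of_nat (Suc n) * (\<Sum>k. cnj (a k) * b (n + k) / of_nat (Suc (n + k)))"

text \<open>Each term is bounded by \<open>x * y \<le> x^2 + y^2\<close> with
  \<open>x = |a_k|\<close> and \<open>y = |b_(n+k)| / (n + k + 1)\<close>. The bound does not depend
  on \<open>n\<close>, which provides the dominating series in
  \<open>antiproj_partial_sum_tendsto\<close>.\<close>

lemma bergman_coeff_abs_bound:
  assumes a: "summable (\<lambda>k. (cmod (a k))\<^sup>2)" and b: "summable (\<lambda>n. (cmod (b n))\<^sup>2 / real (Suc n))"
  shows "summable (\<lambda>k. cmod (cnj (a k) * b (n + k) / of_nat (Suc (n + k))))"
    and "(\<Sum>k. cmod (cnj (a k) * b (n + k) / of_nat (Suc (n + k))))
       \<le> (\<Sum>k. (cmod (a k))\<^sup>2) + (\<Sum>n. (cmod (b n))\<^sup>2 / real (Suc n))"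
proof -
  have le: "cmod (cnj (a k) * b (n + k) / of_nat (Suc (n + k)))
      \<le> (cmod (a k))\<^sup>2 + (cmod (b (k + n)))\<^sup>2 / real (Suc (k + n))" for k
  proof -
    define x where "x = cmod (b (k + n)) / real (Suc (k + n))"
    have "cmod (a k) * x \<le> (cmod (a k))\<^sup>2 + x\<^sup>2"
      using sum_squares_bound[of "cmod (a k)" x] zero_le_power2[of "cmod (a k)"] zero_le_power2[of x]
      by linarith
    moreover have "x\<^sup>2 \<le> (cmod (b (k + n)))\<^sup>2 / real (Suc (k + n))"
      unfolding x_def power_divide by (intro divide_left_mono) (simp_all add: power2_eq_square)
    ultimately show ?thesis
      by (simp add: x_def norm_mult norm_divide add.commute[of n k] del: of_nat_Suc)
  qed
  have sb: "summable (\<lambda>k. (cmod (b (k + n)))\<^sup>2 / real (Suc (k + n)))"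
    by (rule summable_ignore_initial_segment[OF b])
  have s: "summable (\<lambda>k. (cmod (a k))\<^sup>2 + (cmod (b (k + n)))\<^sup>2 / real (Suc (k + n)))"
    by (intro summable_add a sb)
  show *: "summable (\<lambda>k. cmod (cnj (a k) * b (n + k) / of_nat (Suc (n + k))))"
    by (rule summable_comparison_test'[OF s]) (use le in simp)
  have "(\<Sum>k. cmod (cnj (a k) * b (n + k) / of_nat (Suc (n + k))))
      \<le> (\<Sum>k. (cmod (a k))\<^sup>2 + (cmod (b (k + n)))\<^sup>2 / real (Suc (k + n)))"
    by (rule suminf_le[OF le * s])
  also have "\<dots> = (\<Sum>k. (cmod (a k))\<^sup>2) + (\<Sum>k. (cmod (b (k + n)))\<^sup>2 / real (Suc (k + n)))"
    by (rule suminf_add[symmetric, OF a sb])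
  also have "(\<Sum>k. (cmod (b (k + n)))\<^sup>2 / real (Suc (k + n))) \<le> (\<Sum>n. (cmod (b n))\<^sup>2 / real (Suc n))"
    using suminf_split_initial_segment[OF b, of n] by (simp add: sum_nonneg del: of_nat_Suc)
  finally show "(\<Sum>k. cmod (cnj (a k) * b (n + k) / of_nat (Suc (n + k))))
       \<le> (\<Sum>k. (cmod (a k))\<^sup>2) + (\<Sum>n. (cmod (b n))\<^sup>2 / real (Suc n))" by simp
qed

text \<open>The Bergman projection is a contraction: pair \<open>cnj f * g\<close> with the partial sums of its projection.\<close>

lemma bergman_coeff_sum_le:
  assumes f: "disc_series f a" "summable (\<lambda>k. (cmod (a k))\<^sup>2)"
    and g: "disc_series g b" "summable (\<lambda>n. (cmod (b n))\<^sup>2 / real (Suc n))"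
    and fg: "integrable disc_area (\<lambda>z. (cmod (f z * g z))\<^sup>2)"
  shows "(\<Sum>n<N. (cmod (bergman_coeff a b n))\<^sup>2 / real (Suc n)) \<le> (\<integral>z. (cmod (f z * g z))\<^sup>2 \<partial>disc_area)"
proof -
  let ?P = "bergman_coeff a b"
  \<comment> \<open>The functions \<open>F n\<close> add up to \<open>f * G\<close>, and pairing
    \<open>g\<close> with \<open>f * G\<close> amounts to pairing \<open>cnj f * g\<close> with
    \<open>G\<close>.\<close>
  define G where "G z = (\<Sum>n<N. ?P n * z ^ n)" for z :: complex
  define F where "F n z = ?P n * (z ^ n * f z)" for n and z :: complex
  define c where "c n m = ?P n * (if m < n then 0 else a (m - n))" for n m
  have F: "disc_series (F n) (c n)" for n
    unfolding F_def c_def by (intro disc_series_cmult disc_series_monomial_mult f)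
  have c: "summable (\<lambda>m. (cmod (c n m))\<^sup>2 / real (Suc m))" for n
  proof (rule summable_comparison_test')
    show "summable (\<lambda>m. (cmod (?P n))\<^sup>2 * (if m < n then 0 else (cmod (a (m - n)))\<^sup>2))"
      using f(2) by (intro summable_mult, subst summable_iff_shift[of _ n, symmetric]) simp
    show "norm ((cmod (c n m))\<^sup>2 / real (Suc m)) \<le> (cmod (?P n))\<^sup>2 * (if m < n then 0 else (cmod (a (m - n)))\<^sup>2)" for m
    proof -
      have "x / real (Suc m) \<le> x" if "x \<ge> 0" for x
        using that divide_left_mono[of 1 "real (Suc m)" x] by simp
      then show ?thesis
        by (simp add: c_def norm_mult power_mult_distrib del: of_nat_Suc)
    qed
  qed
  have int: "integrable disc_area (\<lambda>z. Re (g z * cnj (F n z)))" for n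
    using disc_series_inner_product(1)[OF g F c] .
  \<comment> \<open>Pairing \<open>g\<close> with \<open>z ^ n * f\<close> gives a series starting
    at \<open>m = n\<close>; after the shift it is the series in \<open>bergman_coeff\<close>, up to
    the factor \<open>n + 1\<close>.\<close>
  have val: "(\<integral>z. Re (g z * cnj (F n z)) \<partial>disc_area) = (cmod (?P n))\<^sup>2 / real (Suc n)" for n
  proof -
    have "(\<lambda>m. Re (b m * cnj (c n m)) / real (Suc m)) sums (\<integral>z. Re (g z * cnj (F n z)) \<partial>disc_area)"
      using disc_series_inner_product(2)[OF g F c] .
    moreover have "(\<Sum>m<n. Re (b m * cnj (c n m)) / real (Suc m)) = 0"
      by (simp add: c_def)
    ultimately have 1: "(\<lambda>k. Re (b (k + n) * cnj (c n (k + n))) / real (Suc (k + n)))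
        sums (\<integral>z. Re (g z * cnj (F n z)) \<partial>disc_area)"
      using sums_split_initial_segment[of "\<lambda>m. Re (b m * cnj (c n m)) / real (Suc m)" _ n]
      by (metis (no_types, lifting) diff_zero)
    have "(\<lambda>k. cnj (a k) * b (n + k) / of_nat (Suc (n + k))) sums (?P n / of_nat (Suc n))"
      using summable_norm_cancel[OF bergman_coeff_abs_bound(1)[OF f(2) g(2), of n]]
      by (simp add: bergman_coeff_def sums_iff del: of_nat_Suc)
    then have "(\<lambda>k. Re (cnj (?P n) * (cnj (a k) * b (n + k) / of_nat (Suc (n + k)))))
        sums Re (cnj (?P n) * (?P n / of_nat (Suc n)))"
      by (intro sums_Re sums_mult)
    moreover have "Re (cnj (?P n) * (cnj (a k) * b (n + k) / of_nat (Suc (n + k))))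
        = Re (b (k + n) * cnj (c n (k + n))) / real (Suc (k + n))" for k
    proof -
      have "cnj (?P n) * (cnj (a k) * b (n + k) / of_nat (Suc (n + k)))
         = (b (k + n) * cnj (c n (k + n))) / of_real (real (Suc (k + n)))"
        by (simp add: c_def add.commute mult_ac del: of_nat_Suc)
      then show ?thesis by (simp only: Re_divide_of_real)
    qed
    moreover have "Re (cnj (?P n) * (?P n / of_nat (Suc n))) = (cmod (?P n))\<^sup>2 / real (Suc n)"
    proof -
      have "cnj (?P n) * (?P n / of_nat (Suc n)) = of_real ((cmod (?P n))\<^sup>2) / of_real (real (Suc n))"
        by (simp add: complex_norm_square[symmetric] mult.commute del: of_nat_Suc of_real_power)
      then show ?thesis by (simp only: Re_divide_of_real Re_complex_of_real)
    qed
    ultimately have "(\<lambda>k. Re (b (k + n) * cnj (c n (k + n))) / real (Suc (k + n)))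
        sums ((cmod (?P n))\<^sup>2 / real (Suc n))"
      by (simp only:)
    with 1 show ?thesis by (rule sums_unique2)
  qed
  define Y where "Y = (\<Sum>n<N. (cmod (?P n))\<^sup>2 / real (Suc n))"
  have G: "integrable disc_area (\<lambda>z. (cmod (G z))\<^sup>2)" "(\<integral>z. (cmod (G z))\<^sup>2 \<partial>disc_area) = Y"
    unfolding G_def Y_def integral_disc_area_norm2_polynomial
    by (auto intro!: integrable_disc_area_continuous continuous_intros)
  \<comment> \<open>\<open>Y\<close> is the pairing of \<open>cnj f * g\<close> with
    \<open>G\<close> and also the squared norm of \<open>G\<close>. The inequality of arithmetic and
    geometric means leaves \<open>Y / 2\<close> on the right, which is absorbed on the left.\<close>
  have "Y = (\<integral>z. (\<Sum>n<N. Re (g z * cnj (F n z))) \<partial>disc_area)"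
    unfolding Y_def by (subst Bochner_Integration.integral_sum) (simp_all only: int val)
  also have "\<dots> \<le> (\<integral>z. ((cmod (f z * g z))\<^sup>2 + (cmod (G z))\<^sup>2) / 2 \<partial>disc_area)"
  proof (rule integral_mono)
    show "integrable disc_area (\<lambda>z. \<Sum>n<N. Re (g z * cnj (F n z)))"
      by (intro Bochner_Integration.integrable_sum int)
    show "integrable disc_area (\<lambda>z. ((cmod (f z * g z))\<^sup>2 + (cmod (G z))\<^sup>2) / 2)" using fg G by simp
    fix z
    have "(\<Sum>n<N. Re (g z * cnj (F n z))) = Re (g z * cnj (f z * G z))"
      unfolding Re_sum[symmetric] G_def F_def sum_distrib_left cnj_sum
      by (simp only: mult_ac complex_cnj_mult)
    also have "\<dots> \<le> cmod (g z * cnj (f z * G z))" by (rule complex_Re_le_cmod)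
    also have "\<dots> = cmod (f z * g z) * cmod (G z)" by (simp add: norm_mult)
    also have "\<dots> \<le> ((cmod (f z * g z))\<^sup>2 + (cmod (G z))\<^sup>2) / 2"
      using sum_squares_bound[of "cmod (f z * g z)" "cmod (G z)"] by simp
    finally show "(\<Sum>n<N. Re (g z * cnj (F n z))) \<le> ((cmod (f z * g z))\<^sup>2 + (cmod (G z))\<^sup>2) / 2" .
  qed
  also have "\<dots> = ((\<integral>z. (cmod (f z * g z))\<^sup>2 \<partial>disc_area) + Y) / 2"
    using fg G by simp
  finally show ?thesis unfolding Y_def by simp
qed

section \<open>The complementary projection\<close>

text \<open>\<open>z\<^sup>m cnj z\<^sup>k\<close> minus its Bergman projection, and the square of the \<open>L\<^sup>2\<close> norm of this difference.\<close>

definition antiproj :: "nat \<Rightarrow> nat \<Rightarrow> complex \<Rightarrow> complex" where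
  "antiproj k m z = cnj z ^ k * z ^ m
     - (if k \<le> m then of_real (real (Suc (m - k)) / real (Suc m)) * z ^ (m - k) else 0)"

definition antiproj_weight :: "nat \<Rightarrow> nat \<Rightarrow> real" where
  "antiproj_weight k m = (if k \<le> m then (real k)\<^sup>2 / ((real (Suc m))\<^sup>2 * real (Suc (m + k)))
     else 1 / real (Suc (m + k)))"

lemma continuous_antiproj: "continuous_on A (antiproj k m)"
  unfolding antiproj_def by (cases "k \<le> m") (auto intro!: continuous_intros simp del: of_nat_Suc)

text \<open>The projection preserves the degree, so \<open>cnj z ^ k * z ^ m\<close> and its
  projection both have degree \<open>m - k\<close>. For fixed \<open>m\<close> this makes different
  \<open>k\<close> orthogonal.\<close>

lemma antiproj_rotation:
  "antiproj k m (cis t * z) = cis (of_int (int m - int k) * t) * antiproj k m z"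
proof -
  have "cnj (cis t) ^ k * cis t ^ m = cis (of_int (int m - int k) * t)"
    by (simp add: cis_cnj Complex.DeMoivre cis_mult algebra_simps)
  moreover have "cis t ^ (m - k) = cis (of_int (int m - int k) * t)" if "k \<le> m"
    using that by (simp add: Complex.DeMoivre of_nat_diff)
  ultimately show ?thesis
    by (auto simp: antiproj_def power_mult_distrib right_diff_distrib mult_ac)
qed

lemma integral_antiproj: "(\<integral>z. (cmod (antiproj k m z))\<^sup>2 \<partial>disc_area) = antiproj_weight k m"
proof (cases "k \<le> m")
  case False
  then have "(cmod (antiproj k m z))\<^sup>2 = cmod z ^ (2 * (m + k))" for z
    by (simp add: antiproj_def norm_mult norm_power power_add power_mult_distrib flip: power_mult)
       (simp add: mult.commute)
  then show ?thesis
    using False has_bochner_integral_disc_area_radial[of "m + k"]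
    by (simp add: antiproj_weight_def has_bochner_integral_iff del: of_nat_Suc)
next
  case True
  then obtain j where m: "m = k + j" using le_Suc_ex by blast
  \<comment> \<open>Now \<open>antiproj k m z\<close> equals \<open>(|z|^(2k) - c) * z ^ j\<close>,
    so three radial moments suffice.\<close>
  define c where "c = real (Suc j) / real (Suc m)"
  have *: "(cmod (antiproj k m z))\<^sup>2
      = cmod z ^ (2 * (k + m)) - 2 * c * cmod z ^ (2 * m) + c\<^sup>2 * cmod z ^ (2 * j)" for z
  proof -
    have "cnj z ^ k * z ^ k = of_real (cmod z ^ (2 * k))"
      by (metis complex_norm_square mult.commute of_real_power power_mult power_mult_distrib)
    then have "antiproj k m z = of_real (cmod z ^ (2 * k) - c) * z ^ j"
      by (simp add: antiproj_def m c_def power_add left_diff_distrib mult.assoc[symmetric] del: of_nat_Suc)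
    then have "(cmod (antiproj k m z))\<^sup>2 = (cmod z ^ (2 * k) - c)\<^sup>2 * (cmod z ^ j)\<^sup>2"
      by (simp only: norm_mult norm_of_real norm_power power_mult_distrib power2_abs)
    then show ?thesis
      by (simp only: m mult_2 power_add power2_eq_square) (simp only: algebra_simps)
  qed
  have r: "integrable disc_area (\<lambda>z. cmod z ^ (2 * n))"
    "(\<integral>z. cmod z ^ (2 * n) \<partial>disc_area) = 1 / real (Suc n)" for n
    using has_bochner_integral_disc_area_radial[of n] by (auto simp: has_bochner_integral_iff)
  have "(\<integral>z. (cmod (antiproj k m z))\<^sup>2 \<partial>disc_area)
      = 1 / real (Suc (k + m)) - 2 * c / real (Suc m) + c\<^sup>2 / real (Suc j)"
    unfolding * using r by (simp del: distrib_left_numeral of_nat_Suc)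
  \<comment> \<open>The value is \<open>1 / (m + k + 1) - (j + 1) / (m + 1)^2\<close>. As
    \<open>j = m - k\<close>, the product \<open>(j + 1) * (m + k + 1)\<close> is
    \<open>(m + 1)^2 - k^2\<close>, and only \<open>k^2\<close> survives in the numerator.\<close>
  also have "\<dots> = antiproj_weight k m"
    unfolding antiproj_weight_def c_def m using True
    by (simp add: divide_simps) (simp add: power2_eq_square algebra_simps)
  finally show ?thesis .
qed

lemma antiproj_weight_nonneg: "antiproj_weight k m \<ge> 0"
  by (simp add: antiproj_weight_def)

text \<open>The value \<open>1 / (k + 1)\<close> is the squared Bergman norm of
  \<open>z ^ k\<close>, which neither the factor \<open>z ^ m\<close> nor removal of the projection
  can increase. The bound serves for finitely many \<open>m\<close>, where smallness must come from
  \<open>f\<close>.\<close>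

lemma antiproj_weight_le: "antiproj_weight k m \<le> 1 / real (Suc k)"
proof (cases "k \<le> m")
  case True
  have "(real k)\<^sup>2 / ((real (Suc m))\<^sup>2 * real (Suc (m + k))) \<le> (real (Suc m))\<^sup>2 / ((real (Suc m))\<^sup>2 * real (Suc k))"
    using True by (intro frac_le mult_left_mono power_mono) auto
  then show ?thesis using True by (simp add: antiproj_weight_def)
next
  case False
  then show ?thesis by (simp add: antiproj_weight_def divide_simps)
qed

text \<open>The functions \<open>sqrt (m + 1) * z ^ m\<close> form an orthonormal basis of the
  Bergman space, so this bounds the squared Hilbert-Schmidt norm of the big Hankel operator for
  \<open>f = z ^ k\<close>. Linear growth in \<open>k\<close> is what matches the Dirichlet
  seminorm.\<close>

lemma sum_antiproj_weight_le: "(\<Sum>m<M. real (Suc m) * antiproj_weight k m) \<le> 2 * real k"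
proof -
  let ?S = "\<lambda>M. \<Sum>m<M. real (Suc m) * antiproj_weight k m"
  have mono: "?S M \<le> ?S M'" if "M \<le> M'" for M M'
    using that by (intro sum_mono2) (auto intro!: mult_nonneg_nonneg antiproj_weight_nonneg)
  have k: "?S k \<le> real k"
  proof -
    have "?S k \<le> (\<Sum>m<k. 1)"
      by (intro sum_mono) (auto simp: antiproj_weight_def divide_simps)
    then show ?thesis by simp
  qed
  \<comment> \<open>The \<open>k\<close> terms with \<open>m < k\<close> cost at most
    \<open>k\<close>. From \<open>m = k\<close> on, the terms telescope against
    \<open>k^2 / (m + 1)\<close>, which starts at \<open>k^2 / (k + 1) \<le> k\<close>; the
    subtracted remainder is kept so that the induction goes through.\<close>
  have large: "?S M \<le> 2 * real k - (real k)\<^sup>2 / real (Suc M)" if "k \<le> M" for M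
    using that
  proof (induction M rule: dec_induct)
    case base
    have "(real k)\<^sup>2 / real (Suc k) \<le> real k"
      by (simp add: divide_simps power2_eq_square algebra_simps)
    then show ?case using k by linarith
  next
    case (step M)
    have "real (Suc M) * antiproj_weight k M \<le> (real k)\<^sup>2 / real (Suc M) - (real k)\<^sup>2 / real (Suc (Suc M))"
    proof (cases "k = 0")
      case False
      have "real (Suc M) * antiproj_weight k M = (real k)\<^sup>2 / (real (Suc M) * real (Suc (M + k)))"
        using step by (simp add: antiproj_weight_def power2_eq_square)
      also have "\<dots> \<le> (real k)\<^sup>2 / (real (Suc M) * real (Suc (Suc M)))"
        using False by (intro divide_left_mono mult_left_mono) auto
      also have "\<dots> = (real k)\<^sup>2 / real (Suc M) - (real k)\<^sup>2 / real (Suc (Suc M))"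
        by (simp add: divide_simps) (simp add: algebra_simps)
      finally show ?thesis .
    qed (simp add: antiproj_weight_def)
    then show ?case using step.IH by simp
  qed
  have "?S M \<le> ?S (max M k)" by (rule mono) simp
  also have "\<dots> \<le> 2 * real k - (real k)\<^sup>2 / real (Suc (max M k))" by (rule large) simp
  also have "\<dots> \<le> 2 * real k" by simp
  finally show ?thesis .
qed

lemma integral_antiproj_sum:
  "(\<integral>z. (cmod (\<Sum>k<N. cnj (a k) * antiproj k m z))\<^sup>2 \<partial>disc_area)
     = (\<Sum>k<N. (cmod (a k))\<^sup>2 * antiproj_weight k m)"
proof -
  have "(\<integral>z. (cmod (\<Sum>k<N. cnj (a k) * antiproj k m z))\<^sup>2 \<partial>disc_area)
     = (\<Sum>k<N. (cmod (cnj (a k)))\<^sup>2 * (\<integral>z. (cmod (antiproj k m z))\<^sup>2 \<partial>disc_area))"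
    by (rule integral_disc_area_norm2_sum_orthogonal[where d = "\<lambda>k. int m - int k"])
       (rule continuous_antiproj antiproj_rotation | simp add: inj_on_def)+
  then show ?thesis by (simp add: integral_antiproj)
qed

text \<open>Orthogonality is available in \<open>k\<close> only: terms with equal
  \<open>m - k\<close> have the same degree. So the sum over \<open>m\<close> is first split off
  pointwise by the Cauchy-Schwarz inequality, with weights \<open>sqrt (m + 1)\<close>.\<close>

lemma integral_antiproj_bilinear_le:
  assumes "finite J"
  shows "(\<integral>z. (cmod (\<Sum>m\<in>J. b m * (\<Sum>k<N. cnj (a k) * antiproj k m z)))\<^sup>2 \<partial>disc_area)
     \<le> (\<Sum>m\<in>J. (cmod (b m))\<^sup>2 / real (Suc m))
       * (\<Sum>k<N. (cmod (a k))\<^sup>2 * (\<Sum>m\<in>J. real (Suc m) * antiproj_weight k m))"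
proof -
  define u where "u m z = (\<Sum>k<N. cnj (a k) * antiproj k m z)" for m z
  have cont: "continuous_on A (u m)" for A m
    unfolding u_def by (intro continuous_intros continuous_antiproj)
  have int: "integrable disc_area (\<lambda>z. (cmod (u m z))\<^sup>2)" for m
    by (intro integrable_disc_area_continuous continuous_intros cont)
  let ?B = "\<Sum>m\<in>J. (cmod (b m))\<^sup>2 / real (Suc m)"
  have "(\<integral>z. (cmod (\<Sum>m\<in>J. b m * u m z))\<^sup>2 \<partial>disc_area)
      \<le> (\<integral>z. ?B * (\<Sum>m\<in>J. real (Suc m) * (cmod (u m z))\<^sup>2) \<partial>disc_area)"
  proof (rule integral_mono)
    show "integrable disc_area (\<lambda>z. (cmod (\<Sum>m\<in>J. b m * u m z))\<^sup>2)"
      by (intro integrable_disc_area_continuous continuous_intros cont)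
    show "integrable disc_area (\<lambda>z. ?B * (\<Sum>m\<in>J. real (Suc m) * (cmod (u m z))\<^sup>2))"
      using int by (intro integrable_mult_right Bochner_Integration.integrable_sum)
    fix z
    have "cmod (\<Sum>m\<in>J. b m * u m z) \<le> (\<Sum>m\<in>J. (cmod (b m) / sqrt (real (Suc m))) * (sqrt (real (Suc m)) * cmod (u m z)))"
      by (rule sum_norm_le) (simp add: norm_mult del: of_nat_Suc)
    then have "(cmod (\<Sum>m\<in>J. b m * u m z))\<^sup>2
       \<le> (\<Sum>m\<in>J. (cmod (b m) / sqrt (real (Suc m))) * (sqrt (real (Suc m)) * cmod (u m z)))\<^sup>2"
      by (intro power_mono) auto
    also have "\<dots> \<le> (\<Sum>m\<in>J. (cmod (b m) / sqrt (real (Suc m)))\<^sup>2) * (\<Sum>m\<in>J. (sqrt (real (Suc m)) * cmod (u m z))\<^sup>2)"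
      by (rule Cauchy_Schwarz_ineq_sum)
    also have "\<dots> = ?B * (\<Sum>m\<in>J. real (Suc m) * (cmod (u m z))\<^sup>2)"
      by (simp add: power_divide power_mult_distrib del: of_nat_Suc)
    finally show "(cmod (\<Sum>m\<in>J. b m * u m z))\<^sup>2 \<le> ?B * (\<Sum>m\<in>J. real (Suc m) * (cmod (u m z))\<^sup>2)" .
  qed
  also have "\<dots> = ?B * (\<Sum>m\<in>J. real (Suc m) * (\<Sum>k<N. (cmod (a k))\<^sup>2 * antiproj_weight k m))"
    using int integral_antiproj_sum[of a _ N] by (simp add: u_def del: of_nat_Suc)
  also have "(\<Sum>m\<in>J. real (Suc m) * (\<Sum>k<N. (cmod (a k))\<^sup>2 * antiproj_weight k m))
      = (\<Sum>k<N. (cmod (a k))\<^sup>2 * (\<Sum>m\<in>J. real (Suc m) * antiproj_weight k m))"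
    unfolding sum_distrib_left by (subst sum.swap) (simp add: mult_ac)
  finally show ?thesis unfolding u_def .
qed

lemma norm2_add_le: "(cmod (x + y))\<^sup>2 \<le> 2 * (cmod x)\<^sup>2 + 2 * (cmod y)\<^sup>2"
proof -
  have "(cmod (x + y))\<^sup>2 \<le> (cmod x + cmod y)\<^sup>2"
    by (intro power_mono norm_triangle_ineq norm_ge_zero)
  then show ?thesis
    using sum_squares_bound[of "cmod x" "cmod y"] by (simp add: power2_sum)
qed

text \<open>The sum over \<open>m\<close> is cut at \<open>M\<close>. In the head the weights are
  bounded crudely, so that \<open>a\<close> enters through its Bergman norm; in the tail the
  Hilbert-Schmidt bound applies and smallness comes from \<open>b\<close>. A bound of the head by
  the Dirichlet seminorm would only stay bounded along weakly null sequences.\<close>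

lemma antiproj_partial_sum_le:
  assumes a: "summable (\<lambda>k. real k * (cmod (a k))\<^sup>2)"
    and a1: "summable (\<lambda>k. (cmod (a k))\<^sup>2 / real (Suc k))"
    and b: "summable (\<lambda>n. (cmod (b n))\<^sup>2 / real (Suc n))" and "M \<le> N"
  shows "(\<integral>z. (cmod (\<Sum>m<N. b m * (\<Sum>k<N. cnj (a k) * antiproj k m z)))\<^sup>2 \<partial>disc_area)
    \<le> 2 * (real M)\<^sup>2 * (\<Sum>n. (cmod (b n))\<^sup>2 / real (Suc n)) * (\<Sum>k. (cmod (a k))\<^sup>2 / real (Suc k))
      + 4 * (\<Sum>n. (cmod (b (n + M)))\<^sup>2 / real (Suc (n + M))) * (\<Sum>k. real k * (cmod (a k))\<^sup>2)"
proof -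
  define U where "U J z = (\<Sum>m\<in>J. b m * (\<Sum>k<N. cnj (a k) * antiproj k m z))" for J z
  let ?\<beta> = "\<Sum>n. (cmod (b n))\<^sup>2 / real (Suc n)"
  let ?\<beta>' = "\<Sum>n. (cmod (b (n + M)))\<^sup>2 / real (Suc (n + M))"
  let ?\<alpha> = "\<Sum>k. (cmod (a k))\<^sup>2 / real (Suc k)"
  let ?\<alpha>' = "\<Sum>k. real k * (cmod (a k))\<^sup>2"
  have cont: "continuous_on A (U J)" for A J
    unfolding U_def by (intro continuous_intros continuous_antiproj)
  have int: "integrable disc_area (\<lambda>z. (cmod (U J z))\<^sup>2)" for J
    by (intro integrable_disc_area_continuous continuous_intros cont)
  have head: "(\<integral>z. (cmod (U {..<M} z))\<^sup>2 \<partial>disc_area) \<le> ?\<beta> * ((real M)\<^sup>2 * ?\<alpha>)"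
  proof -
    \<comment> \<open>The number of terms and each factor \<open>m + 1\<close> are at most
      \<open>M\<close>, whence \<open>M^2\<close>.\<close>
    have "(\<Sum>m<M. real (Suc m) * antiproj_weight k m) \<le> (real M)\<^sup>2 / real (Suc k)" for k
    proof -
      have "(\<Sum>m<M. real (Suc m) * antiproj_weight k m) \<le> (\<Sum>m<M. real M * (1 / real (Suc k)))"
        by (intro sum_mono mult_mono antiproj_weight_le antiproj_weight_nonneg) auto
      then show ?thesis by (simp add: power2_eq_square)
    qed
    then have "(\<Sum>k<N. (cmod (a k))\<^sup>2 * (\<Sum>m<M. real (Suc m) * antiproj_weight k m))
       \<le> (\<Sum>k<N. (cmod (a k))\<^sup>2 * ((real M)\<^sup>2 / real (Suc k)))"
      by (intro sum_mono mult_left_mono) auto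
    also have "\<dots> = (real M)\<^sup>2 * (\<Sum>k<N. (cmod (a k))\<^sup>2 / real (Suc k))"
      by (simp add: sum_distrib_left mult.commute)
    also have "\<dots> \<le> (real M)\<^sup>2 * ?\<alpha>"
      by (intro mult_left_mono sum_le_suminf a1) auto
    finally have "(\<Sum>k<N. (cmod (a k))\<^sup>2 * (\<Sum>m<M. real (Suc m) * antiproj_weight k m)) \<le> (real M)\<^sup>2 * ?\<alpha>" .
    moreover have "(\<Sum>m<M. (cmod (b m))\<^sup>2 / real (Suc m)) \<le> ?\<beta>"
      by (intro sum_le_suminf b) auto
    ultimately have "(\<Sum>m<M. (cmod (b m))\<^sup>2 / real (Suc m))
        * (\<Sum>k<N. (cmod (a k))\<^sup>2 * (\<Sum>m<M. real (Suc m) * antiproj_weight k m)) \<le> ?\<beta> * ((real M)\<^sup>2 * ?\<alpha>)"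
      by (intro mult_mono suminf_nonneg b sum_nonneg mult_nonneg_nonneg antiproj_weight_nonneg) auto
    then show ?thesis
      unfolding U_def using integral_antiproj_bilinear_le[of "{..<M}" b a N, OF finite_lessThan] by linarith
  qed
  have tail: "(\<integral>z. (cmod (U {M..<N} z))\<^sup>2 \<partial>disc_area) \<le> ?\<beta>' * (2 * ?\<alpha>')"
  proof -
    have "(\<Sum>m=M..<N. real (Suc m) * antiproj_weight k m) \<le> 2 * real k" for k
    proof -
      have "(\<Sum>m=M..<N. real (Suc m) * antiproj_weight k m) \<le> (\<Sum>m<N. real (Suc m) * antiproj_weight k m)"
        by (intro sum_mono2 mult_nonneg_nonneg antiproj_weight_nonneg) auto
      then show ?thesis using sum_antiproj_weight_le[where M = N and k = k] by linarith
    qed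
    then have "(\<Sum>k<N. (cmod (a k))\<^sup>2 * (\<Sum>m=M..<N. real (Suc m) * antiproj_weight k m))
       \<le> (\<Sum>k<N. (cmod (a k))\<^sup>2 * (2 * real k))"
      by (intro sum_mono mult_left_mono) auto
    also have "\<dots> = 2 * (\<Sum>k<N. real k * (cmod (a k))\<^sup>2)"
      by (simp add: sum_distrib_left mult_ac)
    also have "\<dots> \<le> 2 * ?\<alpha>'"
      by (intro mult_left_mono sum_le_suminf a) auto
    finally have "(\<Sum>k<N. (cmod (a k))\<^sup>2 * (\<Sum>m=M..<N. real (Suc m) * antiproj_weight k m)) \<le> 2 * ?\<alpha>'" .
    moreover have "(\<Sum>m=M..<N. (cmod (b m))\<^sup>2 / real (Suc m)) \<le> ?\<beta>'"
    proof -
      have "(\<Sum>m=M..<N. (cmod (b m))\<^sup>2 / real (Suc m)) = (\<Sum>n<N - M. (cmod (b (n + M)))\<^sup>2 / real (Suc (n + M)))"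
        using sum.shift_bounds_nat_ivl[of "\<lambda>m. (cmod (b m))\<^sup>2 / real (Suc m)" 0 M "N - M"] \<open>M \<le> N\<close>
        by (simp add: lessThan_atLeast0 del: of_nat_Suc)
      also have "\<dots> \<le> ?\<beta>'"
        by (intro sum_le_suminf summable_ignore_initial_segment[OF b]) auto
      finally show ?thesis .
    qed
    ultimately have "(\<Sum>m=M..<N. (cmod (b m))\<^sup>2 / real (Suc m))
        * (\<Sum>k<N. (cmod (a k))\<^sup>2 * (\<Sum>m=M..<N. real (Suc m) * antiproj_weight k m)) \<le> ?\<beta>' * (2 * ?\<alpha>')"
      by (intro mult_mono suminf_nonneg summable_ignore_initial_segment[OF b] sum_nonneg mult_nonneg_nonneg antiproj_weight_nonneg) auto
    then show ?thesis
      unfolding U_def using integral_antiproj_bilinear_le[of "{M..<N}" b a N, OF finite_atLeastLessThan] by linarith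
  qed
  have split: "U {..<N} z = U {..<M} z + U {M..<N} z" for z
    unfolding U_def using \<open>M \<le> N\<close>
    by (subst sum.union_disjoint[symmetric]) (auto intro!: sum.cong)
  have "(\<integral>z. (cmod (U {..<N} z))\<^sup>2 \<partial>disc_area)
     \<le> (\<integral>z. 2 * (cmod (U {..<M} z))\<^sup>2 + 2 * (cmod (U {M..<N} z))\<^sup>2 \<partial>disc_area)"
    by (intro integral_mono int Bochner_Integration.integrable_add integrable_mult_right)
      (simp add: split norm2_add_le)
  also have "\<dots> = 2 * (\<integral>z. (cmod (U {..<M} z))\<^sup>2 \<partial>disc_area) + 2 * (\<integral>z. (cmod (U {M..<N} z))\<^sup>2 \<partial>disc_area)"
    using int by simp
  also have "\<dots> \<le> 2 * (?\<beta> * ((real M)\<^sup>2 * ?\<alpha>)) + 2 * (?\<beta>' * (2 * ?\<alpha>'))"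
    using head tail by linarith
  finally show ?thesis unfolding U_def by (simp only: mult_ac)
qed

text \<open>The projected terms are collected along the diagonals \<open>m - k = n\<close>. With
  both indices below \<open>N\<close>, the diagonal \<open>n\<close> has \<open>N - n\<close> terms,
  so the coefficients on the right are truncations of \<open>bergman_coeff\<close> of a length
  depending on \<open>n\<close>.\<close>

lemma antiproj_partial_sum_eq:
  "(\<Sum>m<N. b m * (\<Sum>k<N. cnj (a k) * antiproj k m z))
    = cnj (\<Sum>k<N. a k * z ^ k) * (\<Sum>m<N. b m * z ^ m)
      - (\<Sum>n<N. (of_nat (Suc n) * (\<Sum>k<N - n. cnj (a k) * b (n + k) / of_nat (Suc (n + k)))) * z ^ n)"
proof -
  define h where "h k n = cnj (a k) * b (n + k) / of_nat (Suc (n + k)) * (of_nat (Suc n) * z ^ n)" for k n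
  have "(\<Sum>m<N. b m * (\<Sum>k<N. cnj (a k) * antiproj k m z))
      = (\<Sum>m<N. \<Sum>k<N. (cnj (a k) * cnj z ^ k) * (b m * z ^ m))
        - (\<Sum>m<N. \<Sum>k<N. if k \<le> m then h k (m - k) else 0)"
    unfolding sum_subtractf[symmetric] sum_distrib_left
    by (intro sum.cong refl) (simp add: antiproj_def h_def right_diff_distrib mult_ac)
  also have "(\<Sum>m<N. \<Sum>k<N. (cnj (a k) * cnj z ^ k) * (b m * z ^ m))
      = cnj (\<Sum>k<N. a k * z ^ k) * (\<Sum>m<N. b m * z ^ m)"
    by (subst sum.swap) (simp add: sum_product)
  also have "(\<Sum>m<N. \<Sum>k<N. if k \<le> m then h k (m - k) else 0) = (\<Sum>m<N. \<Sum>k\<le>m. h k (m - k))"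
  proof (rule sum.cong[OF refl])
    fix m assume "m \<in> {..<N}"
    then have "{..m} = {k \<in> {..<N}. k \<le> m}" by auto
    then show "(\<Sum>k<N. if k \<le> m then h k (m - k) else 0) = (\<Sum>k\<le>m. h k (m - k))"
      by (simp only: sum.inter_filter finite_lessThan)
  qed
  also have "\<dots> = (\<Sum>(k, n)\<in>{(k, n). k + n < N}. h k n)"
    by (rule sum.triangle_reindex[symmetric])
  also have "\<dots> = (\<Sum>(n, k)\<in>(SIGMA n:{..<N}. {..<N - n}). h k n)"
    by (rule sum.reindex_bij_witness[of _ "\<lambda>(n, k). (k, n)" "\<lambda>(k, n). (n, k)"]) auto
  also have "\<dots> = (\<Sum>n<N. \<Sum>k<N - n. h k n)"
    by (rule sum.Sigma[symmetric]) auto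
  also have "\<dots> = (\<Sum>n<N. (of_nat (Suc n) * (\<Sum>k<N - n. cnj (a k) * b (n + k) / of_nat (Suc (n + k)))) * z ^ n)"
    by (simp add: h_def sum_distrib_left sum_distrib_right mult_ac del: of_nat_Suc)
  finally show ?thesis .
qed

lemma summable_norm2_of_weighted:
  fixes a :: "nat \<Rightarrow> complex"
  assumes "summable (\<lambda>k. real k * (cmod (a k))\<^sup>2)"
  shows "summable (\<lambda>k. (cmod (a k))\<^sup>2)"
proof (rule summable_comparison_test'[OF assms, of 1])
  fix k :: nat assume "1 \<le> k"
  then have "1 * (cmod (a k))\<^sup>2 \<le> real k * (cmod (a k))\<^sup>2"
    by (intro mult_right_mono) auto
  then show "norm ((cmod (a k))\<^sup>2) \<le> real k * (cmod (a k))\<^sup>2" by simp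
qed

lemma summable_norm2_divide_Suc:
  fixes a :: "nat \<Rightarrow> complex"
  assumes "summable (\<lambda>k. (cmod (a k))\<^sup>2)"
  shows "summable (\<lambda>k. (cmod (a k))\<^sup>2 / real (Suc k))"
proof (rule summable_comparison_test'[OF assms, of 0])
  fix k :: nat
  have "(cmod (a k))\<^sup>2 / real (Suc k) \<le> (cmod (a k))\<^sup>2 / 1"
    by (intro divide_left_mono) auto
  then show "norm ((cmod (a k))\<^sup>2 / real (Suc k)) \<le> (cmod (a k))\<^sup>2" by simp
qed

lemma bergman_coeff_norm_le:
  assumes a: "summable (\<lambda>k. (cmod (a k))\<^sup>2)" and b: "summable (\<lambda>n. (cmod (b n))\<^sup>2 / real (Suc n))"
  shows "cmod (\<Sum>k<N. cnj (a k) * b (n + k) / of_nat (Suc (n + k)))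
    \<le> (\<Sum>k. (cmod (a k))\<^sup>2) + (\<Sum>n. (cmod (b n))\<^sup>2 / real (Suc n))"
proof -
  have "cmod (\<Sum>k<N. cnj (a k) * b (n + k) / of_nat (Suc (n + k)))
    \<le> (\<Sum>k<N. cmod (cnj (a k) * b (n + k) / of_nat (Suc (n + k))))"
    by (rule norm_sum)
  also have "\<dots> \<le> (\<Sum>k. cmod (cnj (a k) * b (n + k) / of_nat (Suc (n + k))))"
    by (intro sum_le_suminf bergman_coeff_abs_bound(1)[OF a b]) auto
  finally show ?thesis using bergman_coeff_abs_bound(2)[OF a b, of n] by linarith
qed

text \<open>The coefficient of \<open>z ^ n\<close> changes with \<open>N\<close> together with the
  length of the outer sum, so the limit is taken by Tannery's theorem, with dominating terms
  \<open>(n + 1) * |z|^n * K\<close>.\<close>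

lemma antiproj_partial_sum_tendsto:
  assumes f: "disc_series f a" and a: "summable (\<lambda>k. (cmod (a k))\<^sup>2)"
    and g: "disc_series g b" and b: "summable (\<lambda>n. (cmod (b n))\<^sup>2 / real (Suc n))"
    and z: "z \<in> unit_disc"
  shows "summable (\<lambda>n. bergman_coeff a b n * z ^ n)"
    and "(\<lambda>N. \<Sum>m<N. b m * (\<Sum>k<N. cnj (a k) * antiproj k m z))
      \<longlonglongrightarrow> cnj (f z) * g z - (\<Sum>n. bergman_coeff a b n * z ^ n)"
proof -
  define K where "K = (\<Sum>k. (cmod (a k))\<^sup>2) + (\<Sum>n. (cmod (b n))\<^sup>2 / real (Suc n))"
  define T where "T n N = (of_nat (Suc n) * (\<Sum>k<N - n. cnj (a k) * b (n + k) / of_nat (Suc (n + k)))) * z ^ n" for n N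
  have lim: "(\<lambda>N. T n N) \<longlonglongrightarrow> bergman_coeff a b n * z ^ n" for n
  proof -
    have "(\<lambda>N. \<Sum>k<N. cnj (a k) * b (n + k) / of_nat (Suc (n + k)))
        \<longlonglongrightarrow> (\<Sum>k. cnj (a k) * b (n + k) / of_nat (Suc (n + k)))"
      by (rule summable_LIMSEQ[OF summable_norm_cancel[OF bergman_coeff_abs_bound(1)[OF a b]]])
    from filterlim_compose[OF this filterlim_minus_const_nat_at_top[of n]] show ?thesis
      unfolding T_def bergman_coeff_def by (intro tendsto_intros)
  qed
  have bound: "norm (T n N) \<le> (real (Suc n) * cmod z ^ n) * K" for n N
  proof -
    have "norm (T n N) = (real (Suc n) * cmod z ^ n)
        * cmod (\<Sum>k<N - n. cnj (a k) * b (n + k) / of_nat (Suc (n + k)))"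
      unfolding T_def norm_mult norm_power norm_of_nat by (simp only: mult_ac)
    also have "\<dots> \<le> (real (Suc n) * cmod z ^ n) * K"
      unfolding K_def by (intro mult_left_mono bergman_coeff_norm_le[OF a b]) auto
    finally show ?thesis .
  qed
  have summ: "summable (\<lambda>n. (real (Suc n) * cmod z ^ n) * K)"
    using geometric_deriv_sums[of "cmod z"] z
    by (intro summable_mult2) (auto simp: sums_iff simp del: of_nat_Suc)
  note tannery = tannerys_theorem[where a = T and F = sequentially, OF lim _ summ]
  have ev: "\<forall>\<^sub>F (n, N) in at_top \<times>\<^sub>F sequentially. norm (T n N) \<le> (real (Suc n) * cmod z ^ n) * K"
    using bound by (intro always_eventually) auto
  show "summable (\<lambda>n. bergman_coeff a b n * z ^ n)"
    using tannery[OF ev] by (auto intro: summable_norm_cancel)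
  \<comment> \<open>For \<open>n \<ge> N\<close> the natural number \<open>N - n\<close> is 0, so
    the inner sum is empty and the series stops at \<open>N\<close>.\<close>
  have "(\<Sum>n. T n N) = (\<Sum>n<N. T n N)" for N
    by (rule suminf_finite) (auto simp: T_def)
  then have T: "(\<lambda>N. \<Sum>n<N. T n N) \<longlonglongrightarrow> (\<Sum>n. bergman_coeff a b n * z ^ n)"
    using tannery[OF ev] by simp
  have "(\<lambda>N. \<Sum>k<N. a k * z ^ k) \<longlonglongrightarrow> f z" "(\<lambda>N. \<Sum>k<N. b k * z ^ k) \<longlonglongrightarrow> g z"
    using f g z by (auto simp: disc_series_def sums_def)
  then show "(\<lambda>N. \<Sum>m<N. b m * (\<Sum>k<N. cnj (a k) * antiproj k m z))
      \<longlonglongrightarrow> cnj (f z) * g z - (\<Sum>n. bergman_coeff a b n * z ^ n)"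
    unfolding antiproj_partial_sum_eq T_def[symmetric] by (intro tendsto_intros T)
qed

text \<open>A quantitative form of the compactness of the big Hankel operator \<open>g \<mapsto> (I - P)(cnj f * g)\<close>,
  which is Hilbert-Schmidt on the Bergman space because \<open>f\<close> belongs to the Dirichlet space.\<close>

lemma big_hankel_le:
  assumes f: "disc_series f a" and a: "summable (\<lambda>k. real k * (cmod (a k))\<^sup>2)"
    and g: "disc_series g b" and b: "summable (\<lambda>n. (cmod (b n))\<^sup>2 / real (Suc n))"
  shows "(\<integral>\<^sup>+z. ennreal ((cmod (cnj (f z) * g z - (\<Sum>n. bergman_coeff a b n * z ^ n)))\<^sup>2) \<partial>disc_area)
    \<le> ennreal (2 * (real M)\<^sup>2 * (\<Sum>n. (cmod (b n))\<^sup>2 / real (Suc n)) * (\<Sum>k. (cmod (a k))\<^sup>2 / real (Suc k))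
      + 4 * (\<Sum>n. (cmod (b (n + M)))\<^sup>2 / real (Suc (n + M))) * (\<Sum>k. real k * (cmod (a k))\<^sup>2))"
    (is "_ \<le> ennreal ?B")
proof -
  define R where "R N z = (\<Sum>m<N. b m * (\<Sum>k<N. cnj (a k) * antiproj k m z))" for N z
  note a0 = summable_norm2_of_weighted[OF a]
  note a1 = summable_norm2_divide_Suc[OF a0]
  have cont: "continuous_on A (R N)" for A N
    unfolding R_def by (intro continuous_intros continuous_antiproj)
  have int: "integrable disc_area (\<lambda>z. (cmod (R N z))\<^sup>2)" for N
    by (intro integrable_disc_area_continuous continuous_intros cont)
  have "(\<integral>\<^sup>+z. ennreal ((cmod (cnj (f z) * g z - (\<Sum>n. bergman_coeff a b n * z ^ n)))\<^sup>2) \<partial>disc_area)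
      = (\<integral>\<^sup>+z. liminf (\<lambda>N. ennreal ((cmod (R N z))\<^sup>2)) \<partial>disc_area)"
  proof (rule nn_integral_cong)
    fix z assume "z \<in> space disc_area"
    then have "(\<lambda>N. ennreal ((cmod (R N z))\<^sup>2))
        \<longlonglongrightarrow> ennreal ((cmod (cnj (f z) * g z - (\<Sum>n. bergman_coeff a b n * z ^ n)))\<^sup>2)"
      unfolding R_def by (intro tendsto_ennrealI tendsto_intros antiproj_partial_sum_tendsto[OF f a0 g b]) simp
    from lim_imp_Liminf[OF _ this]
    show "ennreal ((cmod (cnj (f z) * g z - (\<Sum>n. bergman_coeff a b n * z ^ n)))\<^sup>2)
        = liminf (\<lambda>N. ennreal ((cmod (R N z))\<^sup>2))" by simp
  qed
  \<comment> \<open>Square integrability of the limit is not known in advance; Fatou's lemma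
    supplies it from the bounds on the partial sums with \<open>N \<ge> M\<close>.\<close>
  also have "\<dots> \<le> liminf (\<lambda>N. \<integral>\<^sup>+z. ennreal ((cmod (R N z))\<^sup>2) \<partial>disc_area)"
    by (rule nn_integral_liminf) (use int in measurable)
  also have "\<dots> \<le> liminf (\<lambda>N. ennreal ?B)"
  proof (rule Liminf_mono)
    show "\<forall>\<^sub>F N in sequentially. (\<integral>\<^sup>+z. ennreal ((cmod (R N z))\<^sup>2) \<partial>disc_area) \<le> ennreal ?B"
      using eventually_ge_at_top[of M]
    proof eventually_elim
      case (elim N)
      have "(\<integral>z. (cmod (R N z))\<^sup>2 \<partial>disc_area) \<le> ?B"
        unfolding R_def by (rule antiproj_partial_sum_le[OF a a1 b elim])
      then show ?case
        by (subst nn_integral_eq_integral[OF int]) (auto intro: ennreal_leI)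
    qed
  qed
  also have "\<dots> = ennreal ?B" by (simp add: Liminf_const)
  finally show ?thesis .
qed

text \<open>Bounded, coordinatewise null sequences in \<open>l^2\<close> are weakly null: far
  coordinates are controlled by the tail of \<open>c\<close>, the finitely many others by
  \<open>lim\<close>. The field stays general because the lemma is applied to complex coefficients
  and to their squared moduli.\<close>

lemma suminf_mult_tendsto_0:
  fixes c :: "nat \<Rightarrow> 'a::{real_normed_field, banach}" and A :: "nat \<Rightarrow> nat \<Rightarrow> 'a"
  assumes c: "summable (\<lambda>k. (norm (c k))\<^sup>2)" and A: "\<And>j. summable (\<lambda>k. (norm (A j k))\<^sup>2)"
    and C: "\<And>j. (\<Sum>k. (norm (A j k))\<^sup>2) \<le> C" and lim: "\<And>k. (\<lambda>j. A j k) \<longlonglongrightarrow> 0"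
  shows "(\<lambda>j. \<Sum>k. c k * A j k) \<longlonglongrightarrow> 0"
proof (rule LIMSEQ_I)
  fix e :: real assume e: "e > 0"
  have C0: "C \<ge> 0" using C[of 0] suminf_nonneg[OF A, of 0] by simp
  have amgm: "norm (c k * A j k) \<le> (t * (norm (c k))\<^sup>2 + (norm (A j k))\<^sup>2 / t) / 2" if "t > 0" for t j k
  proof -
    have "0 \<le> (t * norm (c k) - norm (A j k))\<^sup>2 / t" using that by simp
    also have "\<dots> = t * (norm (c k))\<^sup>2 + (norm (A j k))\<^sup>2 / t - 2 * norm (c k * A j k)"
      using that by (simp add: power2_diff norm_mult field_simps power2_eq_square)
    finally show ?thesis by simp
  qed
  have summ: "summable (\<lambda>k. norm (c k * A j k))" for j
    by (rule summable_comparison_test'[of "\<lambda>k. (1 * (norm (c k))\<^sup>2 + (norm (A j k))\<^sup>2 / 1) / 2"])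
       (intro summable_divide summable_add summable_mult c A, use amgm[of 1 _ j] in simp)
  \<comment> \<open>In the weighted mean inequality \<open>amgm\<close> this \<open>t\<close> makes
    the part from \<open>A\<close> at most \<open>e / 2\<close>; the summand 1 keeps
    \<open>t\<close> positive when \<open>C = 0\<close>. The cut \<open>K\<close> is then chosen for
    this \<open>t\<close>.\<close>
  define t where "t = 2 * (C + 1) / e"
  have t: "t > 0" "C / t \<le> e / 2" using e C0 by (auto simp: t_def field_simps)
  have "(\<lambda>K. \<Sum>k. (norm (c (k + K)))\<^sup>2) \<longlonglongrightarrow> 0"
    using suminf_exist_split2[OF c] .
  then have "(\<lambda>K. t * (\<Sum>k. (norm (c (k + K)))\<^sup>2)) \<longlonglongrightarrow> t * 0"
    by (intro tendsto_intros)
  then have "\<forall>\<^sub>F K in sequentially. t * (\<Sum>k. (norm (c (k + K)))\<^sup>2) < e / 2"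
    using e by (intro order_tendstoD) auto
  then obtain K where K: "t * (\<Sum>k. (norm (c (k + K)))\<^sup>2) < e / 2"
    by (auto simp: eventually_sequentially)
  have tail: "(\<Sum>k. norm (c (k + K) * A j (k + K))) \<le> e / 2" for j
  proof -
    note cK = summable_ignore_initial_segment[OF c, of K]
    note AK = summable_ignore_initial_segment[OF A[of j], of K]
    have "(\<Sum>k. norm (c (k + K) * A j (k + K)))
        \<le> (\<Sum>k. (t * (norm (c (k + K)))\<^sup>2 + (norm (A j (k + K)))\<^sup>2 / t) / 2)"
      by (intro suminf_le amgm t summable_ignore_initial_segment[OF summ, of K] summable_divide
          summable_add summable_mult cK AK)
    also have "\<dots> = (t * (\<Sum>k. (norm (c (k + K)))\<^sup>2) + (\<Sum>k. (norm (A j (k + K)))\<^sup>2) / t) / 2"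
      by (simp add: suminf_divide suminf_mult suminf_add[symmetric] summable_divide summable_add summable_mult cK AK
          del: summable_iff_shift)
    also have "\<dots> \<le> (e / 2 + e / 2) / 2"
    proof (intro divide_right_mono add_mono)
      have "(\<Sum>k. (norm (A j (k + K)))\<^sup>2) \<le> C"
        using suminf_split_initial_segment[OF A[of j], of K] C[of j] sum_nonneg[of "{..<K}" "\<lambda>k. (norm (A j k))\<^sup>2"]
        by simp
      then show "(\<Sum>k. (norm (A j (k + K)))\<^sup>2) / t \<le> e / 2"
        using t by (meson divide_right_mono less_imp_le order_trans)
    qed (use K in simp_all)
    finally show ?thesis by simp
  qed
  have "(\<lambda>j. \<Sum>k<K. norm (c k * A j k)) \<longlonglongrightarrow> (\<Sum>k<K. 0)"
    by (intro tendsto_sum tendsto_norm_zero tendsto_mult_right_zero lim)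
  then have "\<forall>\<^sub>F j in sequentially. (\<Sum>k<K. norm (c k * A j k)) < e / 2"
    using e by (intro order_tendstoD) auto
  then have "\<forall>\<^sub>F j in sequentially. norm (\<Sum>k. c k * A j k) < e"
  proof eventually_elim
    case (elim j)
    have "norm (\<Sum>k. c k * A j k) \<le> (\<Sum>k. norm (c k * A j k))"
      by (rule summable_norm[OF summ])
    also have "\<dots> = (\<Sum>k. norm (c (k + K) * A j (k + K))) + (\<Sum>k<K. norm (c k * A j k))"
      by (rule suminf_split_initial_segment[OF summ])
    finally show ?case using elim tail[of j] by linarith
  qed
  then show "\<exists>N. \<forall>j\<ge>N. norm ((\<Sum>k. c k * A j k) - 0) < e"
    by (simp add: eventually_sequentially)
qed

section \<open>The Dirichlet norm in terms of Taylor coefficients\<close>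

definition dirichlet_energy :: "(nat \<Rightarrow> complex) \<Rightarrow> real" where
  "dirichlet_energy a = (cmod (a 0))\<^sup>2 + (\<Sum>k. real k * (cmod (a k))\<^sup>2)"

text \<open>Parseval's identity for the derivative: of the factor \<open>(n + 1)^2\<close> one power
  is cancelled by the Bergman weight. The index shift loses nothing, as the term
  \<open>k = 0\<close> has weight 0.\<close>

lemma disc_series_dirichlet_iff:
  assumes f: "disc_series f a"
  shows "f \<in> dirichlet_space \<longleftrightarrow> summable (\<lambda>k. real k * (cmod (a k))\<^sup>2)"
proof -
  have eq: "(cmod (of_nat (Suc n) * a (Suc n)))\<^sup>2 / real (Suc n) = real (Suc n) * (cmod (a (Suc n)))\<^sup>2" for n
    by (simp only: norm_mult norm_of_nat power_mult_distrib) (simp add: power2_eq_square)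
  have "f \<in> dirichlet_space \<longleftrightarrow> summable (\<lambda>n. (cmod (of_nat (Suc n) * a (Suc n)))\<^sup>2 / real (Suc n))"
    using disc_series_holomorphic[OF f] disc_series_A2_iff[OF disc_series_deriv[OF f]]
    by (simp add: dirichlet_space_def del: of_nat_Suc)
  then show ?thesis
    unfolding eq using summable_Suc_iff[of "\<lambda>k. real k * (cmod (a k))\<^sup>2"] by simp
qed

lemma disc_series_dirichlet_norm:
  assumes f: "disc_series f a" and a: "summable (\<lambda>k. real k * (cmod (a k))\<^sup>2)"
  shows "dirichlet_norm f = sqrt (dirichlet_energy a)"
proof -
  have eq: "(cmod (of_nat (Suc n) * a (Suc n)))\<^sup>2 / real (Suc n) = real (Suc n) * (cmod (a (Suc n)))\<^sup>2" for n
    by (simp only: norm_mult norm_of_nat power_mult_distrib) (simp add: power2_eq_square)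
  have s: "summable (\<lambda>n. (cmod (of_nat (Suc n) * a (Suc n)))\<^sup>2 / real (Suc n))"
    unfolding eq using a by (subst summable_Suc_iff)
  have "(\<integral>z. (cmod (deriv f z))\<^sup>2 \<partial>disc_area) = (\<Sum>k. real k * (cmod (a k))\<^sup>2)"
    using disc_series_A2_sums[OF disc_series_deriv[OF f] s] suminf_split_head[OF a]
    unfolding eq by simp
  moreover have "f 0 = a 0"
    using f unfolding disc_series_def by (auto dest!: bspec[of _ _ 0] simp: sums_iff)
  ultimately show ?thesis by (simp add: dirichlet_norm_def dirichlet_energy_def)
qed

text \<open>The weight \<open>k\<close> is at least 1 for \<open>k \<ge> 1\<close>, and the constant
  coefficient enters through the separate first summand; so the Dirichlet norm dominates the
  \<open>l^2\<close> norm of the coefficients.\<close>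

lemma dirichlet_energy_bounds:
  assumes a: "summable (\<lambda>k. real k * (cmod (a k))\<^sup>2)"
  shows "(\<Sum>k. real k * (cmod (a k))\<^sup>2) \<le> dirichlet_energy a"
    and "(\<Sum>k. (cmod (a k))\<^sup>2) \<le> dirichlet_energy a"
    and "(cmod (a n))\<^sup>2 \<le> dirichlet_energy a"
    and "0 \<le> dirichlet_energy a"
proof -
  note a0 = summable_norm2_of_weighted[OF a]
  show "(\<Sum>k. real k * (cmod (a k))\<^sup>2) \<le> dirichlet_energy a" by (simp add: dirichlet_energy_def)
  have "(\<Sum>k. (cmod (a (Suc k)))\<^sup>2) \<le> (\<Sum>k. real (Suc k) * (cmod (a (Suc k)))\<^sup>2)"
  proof (rule suminf_le)
    show "(cmod (a (Suc k)))\<^sup>2 \<le> real (Suc k) * (cmod (a (Suc k)))\<^sup>2" for k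
      using mult_right_mono[of 1 "real (Suc k)" "(cmod (a (Suc k)))\<^sup>2"] by simp
    show "summable (\<lambda>k. (cmod (a (Suc k)))\<^sup>2)" using a0 by (subst summable_Suc_iff)
    show "summable (\<lambda>k. real (Suc k) * (cmod (a (Suc k)))\<^sup>2)"
      using a summable_Suc_iff[of "\<lambda>k. real k * (cmod (a k))\<^sup>2"] by simp
  qed
  then show *: "(\<Sum>k. (cmod (a k))\<^sup>2) \<le> dirichlet_energy a"
    using suminf_split_head[OF a0] suminf_split_head[OF a] by (simp add: dirichlet_energy_def)
  have "(cmod (a n))\<^sup>2 \<le> (\<Sum>k. (cmod (a k))\<^sup>2)"
    using sum_le_suminf[OF a0, of "{n}"] by simp
  then show "(cmod (a n))\<^sup>2 \<le> dirichlet_energy a" using * by linarith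
  then show "0 \<le> dirichlet_energy a" by (meson order_trans zero_le_power2)
qed

section \<open>Weakly null sequences in the Dirichlet space\<close>

lemma l2_mult_summable:
  fixes c A :: "nat \<Rightarrow> complex"
  assumes c: "summable (\<lambda>k. (cmod (c k))\<^sup>2)" and A: "summable (\<lambda>k. (cmod (A k))\<^sup>2)"
  shows "summable (\<lambda>k. cmod (c k * A k))"
    and "cmod (\<Sum>k. c k * A k) \<le> (\<Sum>k. (cmod (c k))\<^sup>2) + (\<Sum>k. (cmod (A k))\<^sup>2)"
proof -
  have le: "cmod (c k * A k) \<le> (cmod (c k))\<^sup>2 + (cmod (A k))\<^sup>2" for k
    using sum_squares_bound[of "cmod (c k)" "cmod (A k)"] zero_le_power2[of "cmod (c k)"]
      zero_le_power2[of "cmod (A k)"] unfolding norm_mult by linarith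
  show s: "summable (\<lambda>k. cmod (c k * A k))"
    by (rule summable_comparison_test'[OF summable_add[OF c A]]) (use le in simp)
  have "cmod (\<Sum>k. c k * A k) \<le> (\<Sum>k. cmod (c k * A k))"
    by (rule summable_norm[OF s])
  also have "\<dots> \<le> (\<Sum>k. (cmod (c k))\<^sup>2 + (cmod (A k))\<^sup>2)"
    by (rule suminf_le[OF le s summable_add[OF c A]])
  also have "\<dots> = (\<Sum>k. (cmod (c k))\<^sup>2) + (\<Sum>k. (cmod (A k))\<^sup>2)"
    by (rule suminf_add[symmetric, OF c A])
  finally show "cmod (\<Sum>k. c k * A k) \<le> (\<Sum>k. (cmod (c k))\<^sup>2) + (\<Sum>k. (cmod (A k))\<^sup>2)" .
qed

lemma summable_norm2_power:
  assumes "z \<in> unit_disc"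
  shows "summable (\<lambda>k. (cmod (z ^ k))\<^sup>2)"
proof -
  have "(cmod z)\<^sup>2 < 1" using assms by (simp add: abs_square_less_1)
  then have "summable (\<lambda>k. ((cmod z)\<^sup>2) ^ k)" by (intro summable_geometric) simp
  then show ?thesis by (simp add: norm_power power_mult[symmetric] mult.commute)
qed

lemma l2_disc_series:
  assumes "summable (\<lambda>k. (cmod (a k))\<^sup>2)"
  shows "disc_series (\<lambda>z. \<Sum>k. a k * z ^ k) a"
  unfolding disc_series_def
  by (intro ballI summable_sums summable_norm_cancel[OF l2_mult_summable(1)[OF assms summable_norm2_power]])

lemma dirichlet_disc_series: "f \<in> dirichlet_space \<Longrightarrow> disc_series f (taylor_coeff f)"
  by (intro disc_series_taylor) (simp add: dirichlet_space_def)

lemma dirichlet_summable: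
  "f \<in> dirichlet_space \<Longrightarrow> summable (\<lambda>k. real k * (cmod (taylor_coeff f k))\<^sup>2)"
  using disc_series_dirichlet_iff[OF dirichlet_disc_series] by simp

lemma dirichlet_norm_eq:
  "f \<in> dirichlet_space \<Longrightarrow> dirichlet_norm f = sqrt (dirichlet_energy (taylor_coeff f))"
  by (intro disc_series_dirichlet_norm dirichlet_disc_series dirichlet_summable)

lemma dirichlet_norm_eq_0:
  assumes "disc_series f (\<lambda>_. 0)"
  shows "dirichlet_norm f = 0"
  using disc_series_dirichlet_norm[OF assms] by (simp add: dirichlet_energy_def)

lemma dirichlet_space_add:
  assumes "f \<in> dirichlet_space" "g \<in> dirichlet_space"
  shows "(\<lambda>z. f z + g z) \<in> dirichlet_space"
  using disc_series_dirichlet_iff[OF disc_series_add[OF dirichlet_disc_series dirichlet_disc_series, OF assms]]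
    summable_norm2_add[of "taylor_coeff f" real "taylor_coeff g"] assms[THEN dirichlet_summable]
  by (simp add: mult.commute)

lemma dirichlet_space_cmult:
  assumes "f \<in> dirichlet_space"
  shows "(\<lambda>z. c * f z) \<in> dirichlet_space"
  using disc_series_dirichlet_iff[OF disc_series_cmult[OF dirichlet_disc_series, OF assms, of c]]
    summable_mult[OF dirichlet_summable[OF assms], of "(cmod c)\<^sup>2"]
  by (simp add: norm_mult power_mult_distrib mult_ac)

lemma dirichlet_space_diff:
  assumes "f \<in> dirichlet_space" "g \<in> dirichlet_space"
  shows "(\<lambda>z. f z - g z) \<in> dirichlet_space"
  using dirichlet_space_add[OF assms(1) dirichlet_space_cmult[OF assms(2), of "-1"]] by simp

lemma taylor_coeff_add:
  assumes "f \<in> dirichlet_space" "g \<in> dirichlet_space"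
  shows "taylor_coeff (\<lambda>z. f z + g z) = (\<lambda>k. taylor_coeff f k + taylor_coeff g k)"
  by (intro disc_series_taylor_coeff disc_series_add dirichlet_disc_series assms)

lemma taylor_coeff_diff:
  assumes "f \<in> dirichlet_space" "g \<in> dirichlet_space"
  shows "taylor_coeff (\<lambda>z. f z - g z) = (\<lambda>k. taylor_coeff f k - taylor_coeff g k)"
  by (intro disc_series_taylor_coeff disc_series_diff dirichlet_disc_series assms)

lemma taylor_coeff_cmult:
  assumes "f \<in> dirichlet_space"
  shows "taylor_coeff (\<lambda>z. c * f z) = (\<lambda>k. c * taylor_coeff f k)"
  by (intro disc_series_taylor_coeff disc_series_cmult dirichlet_disc_series assms)

lemma dirichlet_energy_diff_le:
  assumes a: "summable (\<lambda>k. real k * (cmod (a k))\<^sup>2)" and b: "summable (\<lambda>k. real k * (cmod (b k))\<^sup>2)"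
  shows "dirichlet_energy (\<lambda>k. a k - b k) \<le> 2 * dirichlet_energy a + 2 * dirichlet_energy b"
proof -
  have le: "(cmod (x - y))\<^sup>2 \<le> 2 * (cmod x)\<^sup>2 + 2 * (cmod y)\<^sup>2" for x y
    using norm2_add_le[of x "- y"] by simp
  have le2: "real k * (cmod (a k - b k))\<^sup>2 \<le> 2 * (real k * (cmod (a k))\<^sup>2) + 2 * (real k * (cmod (b k))\<^sup>2)" for k
    using mult_left_mono[OF le, of "real k" "a k" "b k"] by (simp add: algebra_simps)
  have s: "summable (\<lambda>k. 2 * (real k * (cmod (a k))\<^sup>2) + 2 * (real k * (cmod (b k))\<^sup>2))"
    by (intro summable_add summable_mult a b)
  have "(\<Sum>k. real k * (cmod (a k - b k))\<^sup>2)
      \<le> (\<Sum>k. 2 * (real k * (cmod (a k))\<^sup>2) + 2 * (real k * (cmod (b k))\<^sup>2))"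
    by (rule suminf_le[OF le2 summable_comparison_test'[OF s] s]) (use le2 in simp)
  also have "\<dots> = 2 * (\<Sum>k. real k * (cmod (a k))\<^sup>2) + 2 * (\<Sum>k. real k * (cmod (b k))\<^sup>2)"
    by (subst suminf_add[symmetric]) (auto simp: suminf_mult a b intro!: summable_mult)
  finally show ?thesis
    using le[of "a 0" "b 0"] by (simp add: dirichlet_energy_def)
qed

text \<open>Weak convergence to zero, encoded without duality by a norm bound and convergence of
  every coefficient, which is how it is extracted from a bounded sequence.\<close>

definition dirichlet_null :: "(nat \<Rightarrow> complex \<Rightarrow> complex) \<Rightarrow> bool" where
  "dirichlet_null E \<longleftrightarrow> (\<forall>j. E j \<in> dirichlet_space) \<and> (\<exists>C. \<forall>j. dirichlet_norm (E j) \<le> C)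
     \<and> (\<forall>k. (\<lambda>j. taylor_coeff (E j) k) \<longlonglongrightarrow> 0)"

lemma dirichlet_null_subseq:
  assumes "dirichlet_null E" "strict_mono r"
  shows "dirichlet_null (\<lambda>j. E (r j))"
proof -
  have "(\<lambda>j. taylor_coeff (E (r j)) k) \<longlonglongrightarrow> 0" for k
    using LIMSEQ_subseq_LIMSEQ[of "\<lambda>j. taylor_coeff (E j) k" 0 r] assms
    by (simp add: dirichlet_null_def o_def)
  then show ?thesis using assms by (auto simp: dirichlet_null_def)
qed

lemma dirichlet_null_energy:
  assumes "dirichlet_null E"
  obtains C where "C \<ge> 0" "\<And>j. dirichlet_energy (taylor_coeff (E j)) \<le> C"
proof -
  obtain C where C: "\<And>j. dirichlet_norm (E j) \<le> C" and E: "\<And>j. E j \<in> dirichlet_space"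
    using assms by (auto simp: dirichlet_null_def)
  have "dirichlet_energy (taylor_coeff (E j)) \<le> C\<^sup>2" for j
  proof -
    have "sqrt (dirichlet_energy (taylor_coeff (E j))) \<le> C"
      using C[of j] dirichlet_norm_eq[OF E[of j]] by simp
    then show ?thesis by (rule sqrt_le_D)
  qed
  then show ?thesis using that[of "C\<^sup>2"] by simp
qed

text \<open>Weak sequential compactness of balls: the coefficients are uniformly bounded, a diagonal
  argument makes all of them converge along one subsequence, and the limit has finite energy because
  every finite part of the energy passes to the limit.\<close>

lemma dirichlet_bounded_subseq:
  fixes F :: "nat \<Rightarrow> complex \<Rightarrow> complex"
  assumes F: "\<And>j. F j \<in> dirichlet_space" and C: "\<And>j. dirichlet_norm (F j) \<le> C"
  obtains r f where "strict_mono r" "f \<in> dirichlet_space" "dirichlet_null (\<lambda>j z. F (r j) z - f z)"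
proof -
  have energy: "dirichlet_energy (taylor_coeff (F j)) \<le> C\<^sup>2" for j
    using C[of j] dirichlet_norm_eq[OF F[of j]] by (simp add: sqrt_le_D)
  have "0 \<le> dirichlet_norm (F 0)"
    by (simp add: dirichlet_norm_def)
  then have C0: "C \<ge> 0" using C[of 0] by linarith
  have bound: "norm (taylor_coeff (F j) k) \<le> C" for j k
    using order_trans[OF dirichlet_energy_bounds(3)[OF dirichlet_summable[OF F[of j]], of k] energy[of j]] C0
    by (rule power2_le_imp_le)
  obtain r :: "nat \<Rightarrow> nat" where r: "strict_mono r"
    and conv: "\<And>k. k \<in> UNIV \<Longrightarrow> \<exists>l. (\<lambda>j. taylor_coeff (F (r j)) k) \<longlonglongrightarrow> l"
    by (rule function_convergent_subsequence[of "UNIV :: nat set" "\<lambda>j. taylor_coeff (F j)" C])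
       (simp, rule bound, rule that)
  define a where "a k = lim (\<lambda>j. taylor_coeff (F (r j)) k)" for k
  have a: "(\<lambda>j. taylor_coeff (F (r j)) k) \<longlonglongrightarrow> a k" for k
    unfolding a_def using conv[of k] by (simp add: convergent_LIMSEQ_iff[symmetric] convergent_def)
  have "(\<Sum>k<N. real k * (cmod (a k))\<^sup>2) \<le> C\<^sup>2" for N
  proof (rule LIMSEQ_le_const2)
    show "(\<lambda>j. \<Sum>k<N. real k * (cmod (taylor_coeff (F (r j)) k))\<^sup>2) \<longlonglongrightarrow> (\<Sum>k<N. real k * (cmod (a k))\<^sup>2)"
      by (intro tendsto_intros a)
    have "(\<Sum>k<N. real k * (cmod (taylor_coeff (F (r j)) k))\<^sup>2) \<le> C\<^sup>2" for j
    proof -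
      note s = dirichlet_summable[OF F[of "r j"]]
      have "(\<Sum>k<N. real k * (cmod (taylor_coeff (F (r j)) k))\<^sup>2)
          \<le> (\<Sum>k. real k * (cmod (taylor_coeff (F (r j)) k))\<^sup>2)"
        by (intro sum_le_suminf s) auto
      then show ?thesis using dirichlet_energy_bounds(1)[OF s] energy[of "r j"] by linarith
    qed
    then show "\<exists>M. \<forall>j\<ge>M. (\<Sum>k<N. real k * (cmod (taylor_coeff (F (r j)) k))\<^sup>2) \<le> C\<^sup>2" by blast
  qed
  then have asum: "summable (\<lambda>k. real k * (cmod (a k))\<^sup>2)"
    by (intro summableI_nonneg_bounded) auto
  define f where "f z = (\<Sum>k. a k * z ^ k)" for z
  have fs: "disc_series f a"
    unfolding f_def by (intro l2_disc_series summable_norm2_of_weighted asum)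
  then have f: "f \<in> dirichlet_space" and fa: "taylor_coeff f = a"
    using disc_series_dirichlet_iff[OF fs] asum disc_series_taylor_coeff[OF fs] by auto
  note diff = dirichlet_space_diff[OF F f]
  have "dirichlet_null (\<lambda>j z. F (r j) z - f z)"
    unfolding dirichlet_null_def
  proof (intro conjI allI exI)
    fix j
    show "(\<lambda>z. F (r j) z - f z) \<in> dirichlet_space" by (rule diff)
    have "dirichlet_energy (taylor_coeff (\<lambda>z. F (r j) z - f z)) \<le> 2 * C\<^sup>2 + 2 * dirichlet_energy a"
      using dirichlet_energy_diff_le[OF dirichlet_summable[OF F[of "r j"]] asum] energy[of "r j"]
      by (simp add: taylor_coeff_diff[OF F f] fa)
    then show "dirichlet_norm (\<lambda>z. F (r j) z - f z) \<le> sqrt (2 * C\<^sup>2 + 2 * dirichlet_energy a)"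
      by (simp add: dirichlet_norm_eq[OF diff])
  next
    fix k
    show "(\<lambda>j. taylor_coeff (\<lambda>z. F (r j) z - f z) k) \<longlonglongrightarrow> 0"
      using tendsto_diff[OF a[of k] tendsto_const[of "a k"]]
      by (simp add: taylor_coeff_diff[OF F f] fa)
  qed
  with r f show ?thesis by (rule that)
qed

lemma dirichlet_null_suminf:
  assumes E: "dirichlet_null E" and c: "summable (\<lambda>k. (cmod (c k))\<^sup>2)"
  shows "(\<lambda>j. \<Sum>k. c k * taylor_coeff (E j) k) \<longlonglongrightarrow> 0"
proof -
  obtain C where "C \<ge> 0" and C: "\<And>j. dirichlet_energy (taylor_coeff (E j)) \<le> C"
    using dirichlet_null_energy[OF E] by blast
  have s: "summable (\<lambda>k. real k * (cmod (taylor_coeff (E j) k))\<^sup>2)" for j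
    using E by (intro dirichlet_summable) (simp add: dirichlet_null_def)
  show ?thesis
    using E by (intro suminf_mult_tendsto_0[OF c summable_norm2_of_weighted[OF s]
          order_trans[OF dirichlet_energy_bounds(2)[OF s] C]]) (simp add: dirichlet_null_def)
qed

text \<open>Evaluation at \<open>z\<close> is the pairing with the sequence \<open>z ^ k\<close>,
  which lies in \<open>l^2\<close>.\<close>

lemma dirichlet_null_pointwise:
  assumes E: "dirichlet_null E" and z: "z \<in> unit_disc"
  shows "(\<lambda>j. E j z) \<longlonglongrightarrow> 0"
proof -
  have "E j z = (\<Sum>k. z ^ k * taylor_coeff (E j) k)" for j
    using dirichlet_disc_series[of "E j"] E z
    by (simp add: dirichlet_null_def disc_series_def sums_iff mult.commute)
  then show ?thesis
    using dirichlet_null_suminf[OF E summable_norm2_power[OF z]] by simp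
qed

text \<open>This is compactness of the embedding into the Bergman space. The squared moduli of the
  coefficients again form a bounded, coordinatewise null sequence in \<open>l^2\<close>, since
  \<open>|a_k|^4 \<le> C * |a_k|^2\<close>; they are paired with \<open>1 / (k + 1)\<close>.\<close>

lemma dirichlet_null_A2:
  assumes E: "dirichlet_null E"
  shows "(\<lambda>j. \<Sum>k. (cmod (taylor_coeff (E j) k))\<^sup>2 / real (Suc k)) \<longlonglongrightarrow> 0"
proof -
  obtain C where C0: "C \<ge> 0" and C: "\<And>j. dirichlet_energy (taylor_coeff (E j)) \<le> C"
    using dirichlet_null_energy[OF E] by blast
  have s: "summable (\<lambda>k. real k * (cmod (taylor_coeff (E j) k))\<^sup>2)" for j
    using E by (intro dirichlet_summable) (simp add: dirichlet_null_def)
  note s0 = summable_norm2_of_weighted[OF s]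
  have le: "(norm ((cmod (taylor_coeff (E j) k))\<^sup>2))\<^sup>2 \<le> C * (cmod (taylor_coeff (E j) k))\<^sup>2" for j k
    using mult_right_mono[OF order_trans[OF dirichlet_energy_bounds(3)[OF s] C], of "(cmod (taylor_coeff (E j) k))\<^sup>2" j k]
    by (simp add: power2_eq_square)
  have s2: "summable (\<lambda>k. (norm ((cmod (taylor_coeff (E j) k))\<^sup>2))\<^sup>2)" for j
    by (rule summable_comparison_test'[OF summable_mult[OF s0, of C]]) (use le in simp)
  have b2: "(\<Sum>k. (norm ((cmod (taylor_coeff (E j) k))\<^sup>2))\<^sup>2) \<le> C * C" for j
  proof -
    have "(\<Sum>k. (norm ((cmod (taylor_coeff (E j) k))\<^sup>2))\<^sup>2) \<le> (\<Sum>k. C * (cmod (taylor_coeff (E j) k))\<^sup>2)"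
      by (rule suminf_le[OF le s2 summable_mult[OF s0]])
    also have "\<dots> = C * (\<Sum>k. (cmod (taylor_coeff (E j) k))\<^sup>2)"
      by (rule suminf_mult[OF s0])
    also have "\<dots> \<le> C * C"
      using order_trans[OF dirichlet_energy_bounds(2)[OF s] C] C0 by (rule mult_left_mono)
    finally show ?thesis .
  qed
  have c: "summable (\<lambda>k. (norm (1 / real (Suc k)))\<^sup>2)"
    using inverse_squares_sums by (simp add: sums_iff power_divide add.commute)
  have lim: "(\<lambda>j. (cmod (taylor_coeff (E j) k))\<^sup>2) \<longlonglongrightarrow> 0" for k
    using E by (auto simp: dirichlet_null_def intro!: tendsto_eq_intros)
  have "(\<lambda>j. \<Sum>k. 1 / real (Suc k) * (cmod (taylor_coeff (E j) k))\<^sup>2) \<longlonglongrightarrow> 0"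
    by (rule suminf_mult_tendsto_0[OF c s2 b2 lim])
  then show ?thesis by simp
qed

section \<open>The Hankel operator and its symbol\<close>

abbreviation symbol_deriv_coeff :: "(nat \<Rightarrow> complex) \<Rightarrow> nat \<Rightarrow> complex" where
  "symbol_deriv_coeff \<Lambda> n \<equiv> of_nat (Suc n) * cnj (\<Lambda> (Suc n))"

text \<open>The condition that \<open>h\<close> itself belongs to the Dirichlet space. Either side
  of the equivalence implies it, and under it all series defining the Hankel operator
  converge.\<close>

abbreviation dirichlet_symbol :: "(nat \<Rightarrow> complex) \<Rightarrow> bool" where
  "dirichlet_symbol \<Lambda> \<equiv> summable (\<lambda>k. real k * (cmod (\<Lambda> k))\<^sup>2)"

lemma conj_symbol_disc_series:
  assumes "dirichlet_symbol \<Lambda>"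
  shows "disc_series (conj_symbol \<Lambda>) (\<lambda>n. cnj (\<Lambda> n))"
  using l2_disc_series[of "\<lambda>n. cnj (\<Lambda> n)"] summable_norm2_of_weighted[OF assms]
  by (simp add: conj_symbol_def[abs_def])

lemma symbol_deriv_summable:
  assumes "dirichlet_symbol \<Lambda>"
  shows "summable (\<lambda>n. (cmod (symbol_deriv_coeff \<Lambda> n))\<^sup>2 / real (Suc n))"
proof -
  have "(cmod (symbol_deriv_coeff \<Lambda> n))\<^sup>2 / real (Suc n) = real (Suc n) * (cmod (\<Lambda> (Suc n)))\<^sup>2" for n
    by (simp only: norm_mult norm_of_nat power_mult_distrib complex_mod_cnj) (simp add: power2_eq_square)
  then show ?thesis
    using assms summable_Suc_iff[of "\<lambda>k. real k * (cmod (\<Lambda> k))\<^sup>2"] by simp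
qed

lemma hankel_coeff_summable:
  assumes L: "dirichlet_symbol \<Lambda>" and f: "f \<in> dirichlet_space"
  shows "summable (\<lambda>k. cmod (\<Lambda> (n + k) * taylor_coeff f k))"
    and "cmod (hankel_coeff \<Lambda> f n) \<le> (\<Sum>k. (cmod (\<Lambda> k))\<^sup>2) + (\<Sum>k. (cmod (taylor_coeff f k))\<^sup>2)"
proof -
  note L0 = summable_norm2_of_weighted[OF L]
  note f0 = summable_norm2_of_weighted[OF dirichlet_summable[OF f]]
  have Ln: "summable (\<lambda>k. (cmod (\<Lambda> (n + k)))\<^sup>2)"
    using summable_ignore_initial_segment[OF L0, of n] by (simp only: add.commute)
  show "summable (\<lambda>k. cmod (\<Lambda> (n + k) * taylor_coeff f k))"
    by (rule l2_mult_summable(1)[OF Ln f0])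
  have "(\<Sum>k. (cmod (\<Lambda> (n + k)))\<^sup>2) \<le> (\<Sum>k. (cmod (\<Lambda> k))\<^sup>2)"
    using suminf_split_initial_segment[OF L0, of n] sum_nonneg[of "{..<n}" "\<lambda>k. (cmod (\<Lambda> k))\<^sup>2"]
    by (simp add: add.commute)
  then show "cmod (hankel_coeff \<Lambda> f n) \<le> (\<Sum>k. (cmod (\<Lambda> k))\<^sup>2) + (\<Sum>k. (cmod (taylor_coeff f k))\<^sup>2)"
    using l2_mult_summable(2)[OF Ln f0] unfolding hankel_coeff_def by linarith
qed

lemma hankel_op_disc_series:
  assumes L: "dirichlet_symbol \<Lambda>" and f: "f \<in> dirichlet_space"
  shows "disc_series (hankel_op \<Lambda> f) (hankel_coeff \<Lambda> f)"
  unfolding disc_series_def hankel_op_def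
proof
  fix z assume z: "z \<in> unit_disc"
  define K where "K = (\<Sum>k. (cmod (\<Lambda> k))\<^sup>2) + (\<Sum>k. (cmod (taylor_coeff f k))\<^sup>2)"
  have "summable (\<lambda>n. hankel_coeff \<Lambda> f n * z ^ n)"
  proof (rule summable_comparison_test')
    show "summable (\<lambda>n. K * cmod z ^ n)" using z by (intro summable_mult summable_geometric) simp
    show "norm (hankel_coeff \<Lambda> f n * z ^ n) \<le> K * cmod z ^ n" for n
      unfolding norm_mult norm_power K_def
      by (intro mult_right_mono hankel_coeff_summable(2)[OF L f]) simp
  qed
  then show "(\<lambda>n. hankel_coeff \<Lambda> f n * z ^ n) sums (\<Sum>n. hankel_coeff \<Lambda> f n * z ^ n)"
    by (rule summable_sums)
qed

lemma dirichlet_hankel_well_defined: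
  assumes L: "dirichlet_symbol \<Lambda>" and f: "f \<in> dirichlet_space"
  shows "hankel_well_defined \<Lambda> f"
  unfolding hankel_well_defined_def
  using summable_norm_cancel[OF hankel_coeff_summable(1)[OF L f]]
    hankel_op_disc_series[OF L f] disc_series_holomorphic[OF hankel_op_disc_series[OF L f]]
  by (auto simp: disc_series_def sums_iff)

text \<open>The denominator \<open>n + k + 1\<close> cancels the factor brought in by
  differentiating the symbol. What remains is the conjugate of the Hankel sum with index
  \<open>n + 1\<close>, the shift reflecting the derivative of the image.\<close>

lemma bergman_coeff_symbol:
  assumes L: "dirichlet_symbol \<Lambda>" and f: "f \<in> dirichlet_space"
  shows "bergman_coeff (taylor_coeff f) (symbol_deriv_coeff \<Lambda>) n
    = of_nat (Suc n) * cnj (hankel_coeff \<Lambda> f (Suc n))"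
proof -
  have "cnj (hankel_coeff \<Lambda> f (Suc n)) = (\<Sum>k. cnj (\<Lambda> (Suc n + k) * taylor_coeff f k))"
    unfolding hankel_coeff_def
    by (rule bounded_linear.suminf[OF bounded_linear_cnj summable_norm_cancel[OF hankel_coeff_summable(1)[OF L f]]])
  also have "\<dots> = (\<Sum>k. cnj (taylor_coeff f k) * symbol_deriv_coeff \<Lambda> (n + k) / of_nat (Suc (n + k)))"
    by (intro suminf_cong) (simp del: of_nat_Suc)
  finally show ?thesis by (simp add: bergman_coeff_def)
qed

lemma bergman_coeff_symbol_norm:
  assumes L: "dirichlet_symbol \<Lambda>" and f: "f \<in> dirichlet_space"
  shows "(cmod (bergman_coeff (taylor_coeff f) (symbol_deriv_coeff \<Lambda>) n))\<^sup>2 / real (Suc n)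
    = real (Suc n) * (cmod (hankel_coeff \<Lambda> f (Suc n)))\<^sup>2"
  unfolding bergman_coeff_symbol[OF L f]
  by (simp only: norm_mult norm_of_nat power_mult_distrib complex_mod_cnj) (simp add: power2_eq_square)

text \<open>Since \<open>f * h'\<close> is square integrable here, contractivity of the projection,
  in the form \<open>bergman_coeff_sum_le\<close>, bounds all partial sums at once.\<close>

lemma hankel_coeff_energy_le:
  assumes L: "dirichlet_symbol \<Lambda>" and f: "f \<in> dirichlet_space"
    and int: "integrable disc_area (\<lambda>z. (cmod (f z * deriv (conj_symbol \<Lambda>) z))\<^sup>2)"
  shows "summable (\<lambda>k. real k * (cmod (hankel_coeff \<Lambda> f k))\<^sup>2)"
    and "(\<Sum>k. real k * (cmod (hankel_coeff \<Lambda> f k))\<^sup>2)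
      \<le> (\<integral>z. (cmod (f z * deriv (conj_symbol \<Lambda>) z))\<^sup>2 \<partial>disc_area)"
proof -
  let ?X = "\<integral>z. (cmod (f z * deriv (conj_symbol \<Lambda>) z))\<^sup>2 \<partial>disc_area"
  have le: "(\<Sum>n<N. real (Suc n) * (cmod (hankel_coeff \<Lambda> f (Suc n)))\<^sup>2) \<le> ?X" for N
    using bergman_coeff_sum_le[OF dirichlet_disc_series[OF f] summable_norm2_of_weighted[OF dirichlet_summable[OF f]]
        disc_series_deriv[OF conj_symbol_disc_series[OF L]] symbol_deriv_summable[OF L] int, of N]
    unfolding bergman_coeff_symbol_norm[OF L f] .
  have s: "summable (\<lambda>n. real (Suc n) * (cmod (hankel_coeff \<Lambda> f (Suc n)))\<^sup>2)"
    using le by (intro summableI_nonneg_bounded) auto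
  then show s': "summable (\<lambda>k. real k * (cmod (hankel_coeff \<Lambda> f k))\<^sup>2)"
    using summable_Suc_iff[of "\<lambda>k. real k * (cmod (hankel_coeff \<Lambda> f k))\<^sup>2"] by simp
  show "(\<Sum>k. real k * (cmod (hankel_coeff \<Lambda> f k))\<^sup>2) \<le> ?X"
    using suminf_split_head[OF s'] suminf_le_const[OF s le] by simp
qed

text \<open>The converse estimate, with square integrability of \<open>f * h'\<close> as a
  conclusion. As \<open>f\<close> and \<open>cnj f\<close> have the same modulus, it suffices to
  treat \<open>cnj f * h'\<close>. It is the sum of \<open>Q\<close>, whose norm is given by the
  Hankel coefficients, and a remainder bounded by \<open>big_hankel_le\<close>.\<close>

lemma symbol_integral_le:
  assumes L: "dirichlet_symbol \<Lambda>" and f: "f \<in> dirichlet_space"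
    and h: "summable (\<lambda>k. real k * (cmod (hankel_coeff \<Lambda> f k))\<^sup>2)"
  shows "integrable disc_area (\<lambda>z. (cmod (f z * deriv (conj_symbol \<Lambda>) z))\<^sup>2)"
    and "(\<integral>z. (cmod (f z * deriv (conj_symbol \<Lambda>) z))\<^sup>2 \<partial>disc_area)
      \<le> 2 * (\<Sum>k. real k * (cmod (hankel_coeff \<Lambda> f k))\<^sup>2)
        + 2 * (2 * (real M)\<^sup>2 * (\<Sum>n. (cmod (symbol_deriv_coeff \<Lambda> n))\<^sup>2 / real (Suc n))
              * (\<Sum>k. (cmod (taylor_coeff f k))\<^sup>2 / real (Suc k))
            + 4 * (\<Sum>n. (cmod (symbol_deriv_coeff \<Lambda> (n + M)))\<^sup>2 / real (Suc (n + M)))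
              * (\<Sum>k. real k * (cmod (taylor_coeff f k))\<^sup>2))"
proof -
  let ?b = "symbol_deriv_coeff \<Lambda>"
  let ?P = "bergman_coeff (taylor_coeff f) ?b"
  define g where "g = deriv (conj_symbol \<Lambda>)"
  define Q where "Q z = (\<Sum>n. ?P n * z ^ n)" for z
  define B where "B M = 2 * (real M)\<^sup>2 * (\<Sum>n. (cmod (?b n))\<^sup>2 / real (Suc n))
              * (\<Sum>k. (cmod (taylor_coeff f k))\<^sup>2 / real (Suc k))
            + 4 * (\<Sum>n. (cmod (?b (n + M)))\<^sup>2 / real (Suc (n + M)))
              * (\<Sum>k. real k * (cmod (taylor_coeff f k))\<^sup>2)" for M
  note fs = dirichlet_disc_series[OF f] and fa = dirichlet_summable[OF f]
  note f0 = summable_norm2_of_weighted[OF fa]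
  have gs: "disc_series g ?b" unfolding g_def by (intro disc_series_deriv conj_symbol_disc_series L)
  note b = symbol_deriv_summable[OF L]
  have Q: "disc_series Q ?P"
    unfolding disc_series_def Q_def
    using antiproj_partial_sum_tendsto(1)[OF fs f0 gs b] by (auto intro: summable_sums)
  have B0: "B M \<ge> 0" for M
    unfolding B_def
    by (intro add_nonneg_nonneg mult_nonneg_nonneg suminf_nonneg fa summable_norm2_divide_Suc f0 b
        summable_ignore_initial_segment[OF b]) auto
  have Ps: "summable (\<lambda>n. (cmod (?P n))\<^sup>2 / real (Suc n))"
    unfolding bergman_coeff_symbol_norm[OF L f]
    using h summable_Suc_iff[of "\<lambda>k. real k * (cmod (hankel_coeff \<Lambda> f k))\<^sup>2"] by simp
  have Psum: "(\<Sum>n. (cmod (?P n))\<^sup>2 / real (Suc n)) = (\<Sum>k. real k * (cmod (hankel_coeff \<Lambda> f k))\<^sup>2)"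
    unfolding bergman_coeff_symbol_norm[OF L f] using suminf_split_head[OF h] by simp
  have [measurable]: "f \<in> borel_measurable disc_area" "g \<in> borel_measurable disc_area"
      "Q \<in> borel_measurable disc_area"
    using disc_series_measurable fs gs Q by blast+
  have [measurable]: "cnj \<in> borel_measurable borel"
    by (intro borel_measurable_continuous_onI continuous_intros)
  have nn: "(\<integral>\<^sup>+z. ennreal ((cmod (f z * g z))\<^sup>2) \<partial>disc_area)
      \<le> ennreal (2 * (\<Sum>k. real k * (cmod (hankel_coeff \<Lambda> f k))\<^sup>2) + 2 * B M)" for M
  proof -
    have "(\<integral>\<^sup>+z. ennreal ((cmod (f z * g z))\<^sup>2) \<partial>disc_area)
        \<le> (\<integral>\<^sup>+z. 2 * ennreal ((cmod (Q z))\<^sup>2) + 2 * ennreal ((cmod (cnj (f z) * g z - Q z))\<^sup>2) \<partial>disc_area)"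
    proof (rule nn_integral_mono)
      fix z
      have "(cmod (f z * g z))\<^sup>2 = (cmod (Q z + (cnj (f z) * g z - Q z)))\<^sup>2"
        by (simp add: norm_mult)
      also have "\<dots> \<le> 2 * (cmod (Q z))\<^sup>2 + 2 * (cmod (cnj (f z) * g z - Q z))\<^sup>2"
        by (rule norm2_add_le)
      finally have "ennreal ((cmod (f z * g z))\<^sup>2)
          \<le> ennreal (2 * (cmod (Q z))\<^sup>2 + 2 * (cmod (cnj (f z) * g z - Q z))\<^sup>2)"
        by (rule ennreal_leI)
      then show "ennreal ((cmod (f z * g z))\<^sup>2)
          \<le> 2 * ennreal ((cmod (Q z))\<^sup>2) + 2 * ennreal ((cmod (cnj (f z) * g z - Q z))\<^sup>2)"
        by (simp add: ennreal_plus ennreal_mult)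
    qed
    also have "\<dots> = 2 * (\<integral>\<^sup>+z. ennreal ((cmod (Q z))\<^sup>2) \<partial>disc_area)
        + 2 * (\<integral>\<^sup>+z. ennreal ((cmod (cnj (f z) * g z - Q z))\<^sup>2) \<partial>disc_area)"
      by (subst nn_integral_add) (auto simp: nn_integral_cmult)
    also have "\<dots> \<le> 2 * ennreal (\<Sum>k. real k * (cmod (hankel_coeff \<Lambda> f k))\<^sup>2) + 2 * ennreal (B M)"
    proof (intro add_mono mult_left_mono)
      have "(\<integral>\<^sup>+z. ennreal ((cmod (Q z))\<^sup>2) \<partial>disc_area) = ennreal (\<Sum>n. (cmod (?P n))\<^sup>2 / real (Suc n))"
        using Ps by (subst disc_series_parseval[OF Q], intro suminf_ennreal2) auto
      then show "(\<integral>\<^sup>+z. ennreal ((cmod (Q z))\<^sup>2) \<partial>disc_area)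
          \<le> ennreal (\<Sum>k. real k * (cmod (hankel_coeff \<Lambda> f k))\<^sup>2)"
        unfolding Psum by simp
      show "(\<integral>\<^sup>+z. ennreal ((cmod (cnj (f z) * g z - Q z))\<^sup>2) \<partial>disc_area) \<le> ennreal (B M)"
        unfolding Q_def B_def by (rule big_hankel_le[OF fs fa gs b])
    qed auto
    also have "\<dots> = ennreal (2 * (\<Sum>k. real k * (cmod (hankel_coeff \<Lambda> f k))\<^sup>2) + 2 * B M)"
      using B0[of M] suminf_nonneg[OF h] by (simp add: ennreal_plus ennreal_mult)
    finally show ?thesis .
  qed
  have int: "integrable disc_area (\<lambda>z. (cmod (f z * g z))\<^sup>2)"
    using order_le_less_trans[OF nn[of 0] ennreal_less_top]
    by (subst integrable_iff_bounded) auto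
  then show "integrable disc_area (\<lambda>z. (cmod (f z * deriv (conj_symbol \<Lambda>) z))\<^sup>2)"
    by (simp add: g_def)
  have "(\<integral>z. (cmod (f z * g z))\<^sup>2 \<partial>disc_area) \<le> 2 * (\<Sum>k. real k * (cmod (hankel_coeff \<Lambda> f k))\<^sup>2) + 2 * B M"
    using nn[of M] B0[of M] suminf_nonneg[OF h]
    by (subst (asm) nn_integral_eq_integral[OF int]) (auto simp del: ennreal_plus)
  then show "(\<integral>z. (cmod (f z * deriv (conj_symbol \<Lambda>) z))\<^sup>2 \<partial>disc_area)
      \<le> 2 * (\<Sum>k. real k * (cmod (hankel_coeff \<Lambda> f k))\<^sup>2)
        + 2 * (2 * (real M)\<^sup>2 * (\<Sum>n. (cmod (?b n))\<^sup>2 / real (Suc n))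
              * (\<Sum>k. (cmod (taylor_coeff f k))\<^sup>2 / real (Suc k))
            + 4 * (\<Sum>n. (cmod (?b (n + M)))\<^sup>2 / real (Suc (n + M)))
              * (\<Sum>k. real k * (cmod (taylor_coeff f k))\<^sup>2))"
    by (simp only: g_def B_def)
qed

text \<open>The order of choices matters: \<open>M\<close> depends only on the symbol, the energy
  bound and \<open>e\<close>, which makes the tail small for all \<open>j\<close> at once. With
  \<open>M\<close> fixed, the Hankel energies and the Bergman norms tend to zero.\<close>

lemma dirichlet_null_symbol_integral:
  assumes L: "dirichlet_symbol \<Lambda>" and E: "dirichlet_null E"
    and h: "\<And>j. summable (\<lambda>k. real k * (cmod (hankel_coeff \<Lambda> (E j) k))\<^sup>2)"
    and lim: "(\<lambda>j. \<Sum>k. real k * (cmod (hankel_coeff \<Lambda> (E j) k))\<^sup>2) \<longlonglongrightarrow> 0"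
  shows "(\<lambda>j. \<integral>z. (cmod (E j z * deriv (conj_symbol \<Lambda>) z))\<^sup>2 \<partial>disc_area) \<longlonglongrightarrow> 0"
proof (rule LIMSEQ_I)
  fix e :: real assume e: "e > 0"
  let ?b = "symbol_deriv_coeff \<Lambda>"
  define \<beta> where "\<beta> = (\<Sum>n. (cmod (?b n))\<^sup>2 / real (Suc n))"
  define \<beta>' where "\<beta>' M = (\<Sum>n. (cmod (?b (n + M)))\<^sup>2 / real (Suc (n + M)))" for M
  define H where "H j = (\<Sum>k. real k * (cmod (hankel_coeff \<Lambda> (E j) k))\<^sup>2)" for j
  define \<alpha> where "\<alpha> j = (\<Sum>k. (cmod (taylor_coeff (E j) k))\<^sup>2 / real (Suc k))" for j
  have Ed: "E j \<in> dirichlet_space" for j using E by (simp add: dirichlet_null_def)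
  obtain C where C0: "C \<ge> 0" and C: "\<And>j. dirichlet_energy (taylor_coeff (E j)) \<le> C"
    using dirichlet_null_energy[OF E] by blast
  note b = symbol_deriv_summable[OF L]
  have "\<beta>' \<longlonglongrightarrow> 0" unfolding \<beta>'_def by (rule suminf_exist_split2[OF b])
  \<comment> \<open>The 8 is \<open>2 * 4\<close> from \<open>symbol_integral_le\<close>, and
    \<open>C\<close> bounds the squared seminorms of all \<open>E j\<close>.\<close>
  then have "(\<lambda>M. 8 * C * \<beta>' M) \<longlonglongrightarrow> 8 * C * 0" by (intro tendsto_intros)
  then have "\<forall>\<^sub>F M in sequentially. 8 * C * \<beta>' M < e / 2"
    using e by (intro order_tendstoD) auto
  then obtain M where M: "8 * C * \<beta>' M < e / 2" by (auto simp: eventually_sequentially)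
  have "(\<lambda>j. 2 * H j + 4 * (real M)\<^sup>2 * \<beta> * \<alpha> j) \<longlonglongrightarrow> 2 * 0 + 4 * (real M)\<^sup>2 * \<beta> * 0"
    using lim dirichlet_null_A2[OF E] unfolding H_def \<alpha>_def by (intro tendsto_intros)
  then have "\<forall>\<^sub>F j in sequentially. 2 * H j + 4 * (real M)\<^sup>2 * \<beta> * \<alpha> j < e / 2"
    using e by (intro order_tendstoD) auto
  then have "\<forall>\<^sub>F j in sequentially. (\<integral>z. (cmod (E j z * deriv (conj_symbol \<Lambda>) z))\<^sup>2 \<partial>disc_area) < e"
  proof eventually_elim
    case (elim j)
    have "(\<integral>z. (cmod (E j z * deriv (conj_symbol \<Lambda>) z))\<^sup>2 \<partial>disc_area)
       \<le> 2 * H j + 2 * (2 * (real M)\<^sup>2 * \<beta> * \<alpha> j + 4 * \<beta>' M * (\<Sum>k. real k * (cmod (taylor_coeff (E j) k))\<^sup>2))"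
      unfolding H_def \<beta>_def \<beta>'_def \<alpha>_def by (rule symbol_integral_le(2)[OF L Ed h])
    also have "4 * \<beta>' M * (\<Sum>k. real k * (cmod (taylor_coeff (E j) k))\<^sup>2) \<le> 4 * \<beta>' M * C"
    proof (rule mult_left_mono)
      show "(\<Sum>k. real k * (cmod (taylor_coeff (E j) k))\<^sup>2) \<le> C"
        using dirichlet_energy_bounds(1)[OF dirichlet_summable[OF Ed]] C by (rule order_trans)
      show "0 \<le> 4 * \<beta>' M"
        unfolding \<beta>'_def by (intro mult_nonneg_nonneg suminf_nonneg summable_ignore_initial_segment[OF b]) auto
    qed
    finally have "(\<integral>z. (cmod (E j z * deriv (conj_symbol \<Lambda>) z))\<^sup>2 \<partial>disc_area)
       \<le> (2 * H j + 4 * (real M)\<^sup>2 * \<beta> * \<alpha> j) + 8 * C * \<beta>' M" by (simp add: algebra_simps)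
    then show ?case using elim M by linarith
  qed
  moreover have "(\<integral>z. (cmod (E j z * deriv (conj_symbol \<Lambda>) z))\<^sup>2 \<partial>disc_area) \<ge> 0" for j
    by (intro integral_nonneg_AE) auto
  ultimately show "\<exists>N. \<forall>j\<ge>N. norm ((\<integral>z. (cmod (E j z * deriv (conj_symbol \<Lambda>) z))\<^sup>2 \<partial>disc_area) - 0) < e"
    by (simp add: eventually_sequentially)
qed

section \<open>Compactness\<close>

lemma symbol_measure_integral:
  assumes L: "dirichlet_symbol \<Lambda>" and F: "F \<in> borel_measurable disc_area"
  shows "integrable (conj_symbol_measure \<Lambda>) (\<lambda>z. (cmod (F z))\<^sup>2)
      \<longleftrightarrow> integrable disc_area (\<lambda>z. (cmod (F z * deriv (conj_symbol \<Lambda>) z))\<^sup>2)"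
    and "(\<integral>z. (cmod (F z))\<^sup>2 \<partial>conj_symbol_measure \<Lambda>)
      = (\<integral>z. (cmod (F z * deriv (conj_symbol \<Lambda>) z))\<^sup>2 \<partial>disc_area)"
proof -
  have [measurable]: "deriv (conj_symbol \<Lambda>) \<in> borel_measurable disc_area"
    by (rule disc_series_measurable[OF disc_series_deriv[OF conj_symbol_disc_series[OF L]]])
  note F[measurable]
  have eq: "(cmod (deriv (conj_symbol \<Lambda>) z))\<^sup>2 *\<^sub>R (cmod (F z))\<^sup>2 = (cmod (F z * deriv (conj_symbol \<Lambda>) z))\<^sup>2" for z
    by (simp add: norm_mult power_mult_distrib)
  show "integrable (conj_symbol_measure \<Lambda>) (\<lambda>z. (cmod (F z))\<^sup>2)
      \<longleftrightarrow> integrable disc_area (\<lambda>z. (cmod (F z * deriv (conj_symbol \<Lambda>) z))\<^sup>2)"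
    unfolding conj_symbol_measure_def by (subst integrable_density) (auto simp: eq simp del: real_scaleR_def)
  show "(\<integral>z. (cmod (F z))\<^sup>2 \<partial>conj_symbol_measure \<Lambda>)
      = (\<integral>z. (cmod (F z * deriv (conj_symbol \<Lambda>) z))\<^sup>2 \<partial>disc_area)"
    unfolding conj_symbol_measure_def by (subst integral_density) (auto simp: eq simp del: real_scaleR_def)
qed

lemma sets_conj_symbol_measure [measurable_cong]: "sets (conj_symbol_measure \<Lambda>) = sets disc_area"
  by (simp add: conj_symbol_measure_def)

lemma space_conj_symbol_measure [simp]: "space (conj_symbol_measure \<Lambda>) = unit_disc"
  by (simp add: conj_symbol_measure_def)

text \<open>The total mass is the squared Dirichlet seminorm of \<open>h\<close>, so the finiteness
  built into Carleson measures places \<open>h\<close> in the Dirichlet space.\<close>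

lemma finite_conj_symbol_measure_iff:
  assumes h: "disc_series (conj_symbol \<Lambda>) (\<lambda>n. cnj (\<Lambda> n))"
  shows "finite_measure (conj_symbol_measure \<Lambda>) \<longleftrightarrow> dirichlet_symbol \<Lambda>"
proof -
  note d = disc_series_deriv[OF h]
  note disc_series_measurable[OF d, measurable]
  have "emeasure (conj_symbol_measure \<Lambda>) unit_disc
      = (\<integral>\<^sup>+z. ennreal ((cmod (deriv (conj_symbol \<Lambda>) z))\<^sup>2) \<partial>disc_area)"
    unfolding conj_symbol_measure_def
    by (subst emeasure_density) (auto simp: sets_disc_area sets_restrict_space intro!: nn_integral_cong)
  then have "finite_measure (conj_symbol_measure \<Lambda>)
      \<longleftrightarrow> (\<integral>\<^sup>+z. ennreal ((cmod (deriv (conj_symbol \<Lambda>) z))\<^sup>2) \<partial>disc_area) < \<infinity>"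
    by (auto simp: less_top[symmetric] intro: finite_measureI dest: finite_measure.emeasure_finite[where A = unit_disc])
  also have "\<dots> \<longleftrightarrow> integrable disc_area (\<lambda>z. (cmod (deriv (conj_symbol \<Lambda>) z))\<^sup>2)"
    by (subst integrable_iff_bounded) auto
  also have "\<dots> \<longleftrightarrow> conj_symbol \<Lambda> \<in> dirichlet_space"
    using disc_series_holomorphic[OF h] by (simp add: dirichlet_space_def)
  also have "\<dots> \<longleftrightarrow> dirichlet_symbol \<Lambda>"
    by (subst disc_series_dirichlet_iff[OF h]) simp
  finally show ?thesis .
qed

text \<open>The constant 1 picks out the term \<open>k = 0\<close> of each Hankel sum, so its image
  is the series with coefficients \<open>\<Lambda>\<close>, and this image lies in the Dirichlet
  space.\<close>

lemma hankel_compact_imp_dirichlet_symbol: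
  assumes "hankel_compact_on_dirichlet \<Lambda>"
  shows "dirichlet_symbol \<Lambda>"
proof -
  define one :: "complex \<Rightarrow> complex" where "one = (\<lambda>_. 1)"
  define \<delta> :: "nat \<Rightarrow> complex" where "\<delta> n = (if n = 0 then 1 else 0)" for n
  have one: "disc_series one \<delta>"
    unfolding disc_series_def
  proof
    fix z :: complex
    show "(\<lambda>n. \<delta> n * z ^ n) sums one z"
      using sums_single[of 0 "\<lambda>n. z ^ n"] by (simp add: \<delta>_def one_def if_distrib[of "\<lambda>x. x * _"] cong: if_cong)
  qed
  have "summable (\<lambda>k. real k * (cmod (\<delta> k))\<^sup>2)"
    by (rule summable_finite[of "{0}"]) (auto simp: \<delta>_def)
  then have mem: "one \<in> dirichlet_space" using disc_series_dirichlet_iff[OF one] by simp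
  have coeff: "hankel_coeff \<Lambda> one n = \<Lambda> n" for n
  proof -
    have "(\<lambda>k. \<Lambda> (n + k) * taylor_coeff one k) sums \<Lambda> n"
      using sums_single[of 0 "\<lambda>k. \<Lambda> (n + k)"]
      by (simp add: disc_series_taylor_coeff[OF one] \<delta>_def if_distrib[of "\<lambda>x. _ * x"] cong: if_cong)
    then show ?thesis by (simp add: hankel_coeff_def sums_iff)
  qed
  have "disc_series (hankel_op \<Lambda> one) \<Lambda>"
    using assms mem unfolding hankel_compact_on_dirichlet_def hankel_well_defined_def disc_series_def
    by (auto simp: coeff hankel_op_def intro!: summable_sums)
  moreover have "hankel_op \<Lambda> one \<in> dirichlet_space"
    using assms mem by (simp add: hankel_compact_on_dirichlet_def compact_linear_operator_def)
  ultimately show ?thesis using disc_series_dirichlet_iff by blast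
qed

lemma hankel_coeff_diff:
  assumes L: "dirichlet_symbol \<Lambda>" and f: "f \<in> dirichlet_space" and g: "g \<in> dirichlet_space"
  shows "hankel_coeff \<Lambda> (\<lambda>z. f z - g z) n = hankel_coeff \<Lambda> f n - hankel_coeff \<Lambda> g n"
  unfolding hankel_coeff_def taylor_coeff_diff[OF f g] right_diff_distrib
  by (rule suminf_diff[symmetric]; rule summable_norm_cancel, rule hankel_coeff_summable(1)[OF L], fact)

lemma hankel_coeff_add:
  assumes L: "dirichlet_symbol \<Lambda>" and f: "f \<in> dirichlet_space" and g: "g \<in> dirichlet_space"
  shows "hankel_coeff \<Lambda> (\<lambda>z. f z + g z) n = hankel_coeff \<Lambda> f n + hankel_coeff \<Lambda> g n"
  unfolding hankel_coeff_def taylor_coeff_add[OF f g] distrib_left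
  by (rule suminf_add[symmetric]; rule summable_norm_cancel, rule hankel_coeff_summable(1)[OF L], fact)

lemma hankel_coeff_cmult:
  assumes L: "dirichlet_symbol \<Lambda>" and f: "f \<in> dirichlet_space"
  shows "hankel_coeff \<Lambda> (\<lambda>z. c * f z) n = c * hankel_coeff \<Lambda> f n"
  unfolding hankel_coeff_def taylor_coeff_cmult[OF f] mult.left_commute[of _ c]
  by (rule suminf_mult, rule summable_norm_cancel, rule hankel_coeff_summable(1)[OF L f])

lemma dirichlet_null_hankel_coeff:
  assumes L: "dirichlet_symbol \<Lambda>" and E: "dirichlet_null E"
  shows "(\<lambda>j. hankel_coeff \<Lambda> (E j) n) \<longlonglongrightarrow> 0"
  unfolding hankel_coeff_def
  using summable_ignore_initial_segment[OF summable_norm2_of_weighted[OF L], of n]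
  by (intro dirichlet_null_suminf[OF E]) (simp only: add.commute)

lemma dirichlet_measurable: "f \<in> dirichlet_space \<Longrightarrow> f \<in> borel_measurable disc_area"
  by (rule disc_series_measurable[OF dirichlet_disc_series])

text \<open>Compactness is applied to the differences from a weak limit rather than to the bounded
  sequence itself. The weak limit then also serves as the limit in \<open>L2_space\<close>.\<close>

lemma hankel_compact_imp_vanishing_carleson:
  assumes hc: "hankel_compact_on_dirichlet \<Lambda>"
  shows "conj_symbol_analytic \<Lambda>" "vanishing_carleson_dirichlet (conj_symbol_measure \<Lambda>)"
proof -
  note L = hankel_compact_imp_dirichlet_symbol[OF hc]
  note h = conj_symbol_disc_series[OF L]
  show "conj_symbol_analytic \<Lambda>"
    using h disc_series_holomorphic[OF h] by (auto simp: conj_symbol_analytic_def disc_series_def sums_iff)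
  let ?\<nu> = "conj_symbol_measure \<Lambda>"
  have T: "hankel_op \<Lambda> f \<in> dirichlet_space" if "f \<in> dirichlet_space" for f
    using hc that by (simp add: hankel_compact_on_dirichlet_def compact_linear_operator_def)
  have hsum: "summable (\<lambda>k. real k * (cmod (hankel_coeff \<Lambda> f k))\<^sup>2)" if "f \<in> dirichlet_space" for f
    using T[OF that] disc_series_dirichlet_iff[OF hankel_op_disc_series[OF L that]] by simp
  have cpt: "\<exists>G\<in>dirichlet_space. \<exists>s. strict_mono s \<and> (\<lambda>j. dirichlet_norm (\<lambda>z. hankel_op \<Lambda> (E (s j)) z - G z)) \<longlonglongrightarrow> 0"
    if "\<forall>j. E j \<in> dirichlet_space" "\<exists>C. \<forall>j. dirichlet_norm (E j) \<le> C" for E :: "nat \<Rightarrow> complex \<Rightarrow> complex"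
    using hc that by (simp add: hankel_compact_on_dirichlet_def compact_linear_operator_def)
  have L2: "f \<in> L2_space ?\<nu>" if f: "f \<in> dirichlet_space" for f
  proof -
    have "integrable ?\<nu> (\<lambda>z. (cmod (f z))\<^sup>2)"
      using symbol_integral_le(1)[OF L f hsum[OF f]] symbol_measure_integral(1)[OF L dirichlet_measurable[OF f]] by simp
    then show ?thesis using dirichlet_measurable[OF f] by (simp add: L2_space_def) measurable
  qed
  show "vanishing_carleson_dirichlet ?\<nu>"
    unfolding vanishing_carleson_dirichlet_def compact_linear_operator_def
  proof (intro conjI allI ballI impI)
    show "finite_measure ?\<nu>" using finite_conj_symbol_measure_iff[OF h] L by simp
    show "sets ?\<nu> = sets (restrict_space borel unit_disc)"
      by (simp add: sets_conj_symbol_measure sets_disc_area)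
    show "f \<in> L2_space ?\<nu>" if "f \<in> dirichlet_space" for f using L2[OF that] .
    fix F :: "nat \<Rightarrow> complex \<Rightarrow> complex"
    assume "(\<forall>j. F j \<in> dirichlet_space) \<and> (\<exists>C. \<forall>j. dirichlet_norm (F j) \<le> C)"
    then obtain C where F: "\<And>j. F j \<in> dirichlet_space" and C: "\<And>j. dirichlet_norm (F j) \<le> C"
      by blast
    obtain r f where r: "strict_mono r" and f: "f \<in> dirichlet_space" and null: "dirichlet_null (\<lambda>j z. F (r j) z - f z)"
      by (rule dirichlet_bounded_subseq[OF F C]) (rule that)
    define E where "E j z = F (r j) z - f z" for j z
    have E: "dirichlet_null E" using null by (simp add: E_def[abs_def])
    then have Ed: "E j \<in> dirichlet_space" for j by (simp add: dirichlet_null_def)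
    obtain G s where G: "G \<in> dirichlet_space" and s: "strict_mono s"
      and lim: "(\<lambda>j. dirichlet_norm (\<lambda>z. hankel_op \<Lambda> (E (s j)) z - G z)) \<longlonglongrightarrow> 0"
      using cpt[of E] E unfolding dirichlet_null_def by blast
    note Es = dirichlet_null_subseq[OF E s]
    define d where "d j = taylor_coeff (\<lambda>z. hankel_op \<Lambda> (E (s j)) z - G z)" for j
    have d: "d j = (\<lambda>k. hankel_coeff \<Lambda> (E (s j)) k - taylor_coeff G k)" for j
      unfolding d_def taylor_coeff_diff[OF T[OF Ed] G]
      by (simp add: disc_series_taylor_coeff[OF hankel_op_disc_series[OF L Ed]])
    note diff = dirichlet_space_diff[OF T[OF Ed] G]
    have "(\<lambda>j. (dirichlet_norm (\<lambda>z. hankel_op \<Lambda> (E (s j)) z - G z))\<^sup>2) \<longlonglongrightarrow> 0"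
      using tendsto_power[OF lim, of 2] by simp
    then have energy: "(\<lambda>j. dirichlet_energy (d j)) \<longlonglongrightarrow> 0"
      using dirichlet_energy_bounds(4)[OF dirichlet_summable[OF diff]]
      by (simp add: dirichlet_norm_eq[OF diff] d_def)
    \<comment> \<open>The coefficients of the images converge to those of \<open>G\<close> by norm
      convergence, and to 0 because the arguments are weakly null.\<close>
    have "taylor_coeff G k = 0" for k
    proof -
      have "(\<lambda>j. (cmod (d j k))\<^sup>2) \<longlonglongrightarrow> 0"
        by (rule tendsto_sandwich[OF _ _ tendsto_const energy])
           (auto simp: d_def intro!: always_eventually dirichlet_energy_bounds(3) dirichlet_summable diff)
      then have "(\<lambda>j. d j k) \<longlonglongrightarrow> 0"
        using tendsto_real_sqrt by (fastforce intro: tendsto_norm_zero_cancel)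
      moreover have "(\<lambda>j. d j k) \<longlonglongrightarrow> 0 - taylor_coeff G k"
        unfolding d by (intro tendsto_diff dirichlet_null_hankel_coeff[OF L Es] tendsto_const)
      ultimately show ?thesis using LIMSEQ_unique by fastforce
    qed
    then have d': "d j = hankel_coeff \<Lambda> (E (s j))" for j by (simp add: d)
    have "(\<lambda>j. \<Sum>k. real k * (cmod (hankel_coeff \<Lambda> (E (s j)) k))\<^sup>2) \<longlonglongrightarrow> 0"
      by (rule tendsto_sandwich[OF _ _ tendsto_const energy])
         (auto simp: d' intro!: always_eventually suminf_nonneg hsum Ed dirichlet_energy_bounds(1))
    from dirichlet_null_symbol_integral[OF L Es hsum[OF Ed] this]
    have "(\<lambda>j. \<integral>z. (cmod (E (s j) z))\<^sup>2 \<partial>?\<nu>) \<longlonglongrightarrow> 0"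
      by (simp add: symbol_measure_integral(2)[OF L dirichlet_measurable[OF Ed]])
    from tendsto_real_sqrt[OF this]
    have "(\<lambda>j. L2_norm_on ?\<nu> (\<lambda>z. F (r (s j)) z - f z)) \<longlonglongrightarrow> 0"
      by (simp add: L2_norm_on_def E_def)
    then have "(\<lambda>j. L2_norm_on ?\<nu> (\<lambda>z. F ((r \<circ> s) j) z - f z)) \<longlonglongrightarrow> 0" by simp
    moreover have "strict_mono (r \<circ> s)" using r s by (rule strict_mono_o)
    ultimately show "\<exists>g\<in>L2_space ?\<nu>. \<exists>r. strict_mono r \<and> (\<lambda>j. L2_norm_on ?\<nu> (\<lambda>z. F (r j) z - g z)) \<longlonglongrightarrow> 0"
      using L2[OF f] by blast
  \<comment> \<open>Left are the underlying space and linearity; for the identity map the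
    differences are identically zero.\<close>
  qed (simp_all add: L2_norm_on_def)
qed

text \<open>An \<open>L^2\<close> limit of a pointwise null sequence vanishes almost everywhere.
  Fatou's lemma for \<open>E j - G\<close> shows this on the level of integrals, without extracting
  an almost everywhere convergent subsequence.\<close>

lemma L2_limit_of_pointwise_null:
  assumes E: "\<And>j. E j \<in> L2_space \<nu>" and G: "G \<in> L2_space \<nu>"
    and pt: "\<And>z. z \<in> space \<nu> \<Longrightarrow> (\<lambda>j. E j z) \<longlonglongrightarrow> 0"
    and lim: "(\<lambda>j. L2_norm_on \<nu> (\<lambda>z. E j z - G z)) \<longlonglongrightarrow> 0"
  shows "(\<lambda>j. \<integral>z. (cmod (E j z))\<^sup>2 \<partial>\<nu>) \<longlonglongrightarrow> 0"
proof -
  have [measurable]: "E j \<in> borel_measurable \<nu>" "G \<in> borel_measurable \<nu>" for j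
    using E G by (auto simp: L2_space_def)
  have iE: "integrable \<nu> (\<lambda>z. (cmod (E j z))\<^sup>2)" and iG: "integrable \<nu> (\<lambda>z. (cmod (G z))\<^sup>2)" for j
    using E G by (auto simp: L2_space_def)
  have le: "(cmod (x - y))\<^sup>2 \<le> 2 * (cmod x)\<^sup>2 + 2 * (cmod y)\<^sup>2" for x y
    using norm2_add_le[of x "- y"] by simp
  have iD: "integrable \<nu> (\<lambda>z. (cmod (E j z - G z))\<^sup>2)" for j
    by (rule Bochner_Integration.integrable_bound[of _ "\<lambda>z. 2 * (cmod (E j z))\<^sup>2 + 2 * (cmod (G z))\<^sup>2"])
       (use iE iG le in auto)
  define D where "D j = (\<integral>z. (cmod (E j z - G z))\<^sup>2 \<partial>\<nu>)" for j
  have D0: "D j \<ge> 0" for j unfolding D_def by (intro integral_nonneg_AE) auto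
  have D: "D \<longlonglongrightarrow> 0"
    using tendsto_power[OF lim, of 2] D0 by (simp add: L2_norm_on_def D_def[abs_def])
  have "(\<integral>\<^sup>+z. ennreal ((cmod (G z))\<^sup>2) \<partial>\<nu>) = (\<integral>\<^sup>+z. liminf (\<lambda>j. ennreal ((cmod (E j z - G z))\<^sup>2)) \<partial>\<nu>)"
  proof (rule nn_integral_cong)
    fix z assume "z \<in> space \<nu>"
    then have "(\<lambda>j. (cmod (E j z - G z))\<^sup>2) \<longlonglongrightarrow> (cmod (0 - G z))\<^sup>2"
      by (intro tendsto_intros pt)
    then have "(\<lambda>j. ennreal ((cmod (E j z - G z))\<^sup>2)) \<longlonglongrightarrow> ennreal ((cmod (G z))\<^sup>2)"
      by (intro tendsto_ennrealI) simp
    from lim_imp_Liminf[OF _ this]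
    show "ennreal ((cmod (G z))\<^sup>2) = liminf (\<lambda>j. ennreal ((cmod (E j z - G z))\<^sup>2))" by simp
  qed
  also have "\<dots> \<le> liminf (\<lambda>j. \<integral>\<^sup>+z. ennreal ((cmod (E j z - G z))\<^sup>2) \<partial>\<nu>)"
    by (rule nn_integral_liminf) measurable
  also have "\<dots> = liminf (\<lambda>j. ennreal (D j))"
    unfolding D_def by (subst nn_integral_eq_integral[OF iD]) auto
  also have "\<dots> = 0"
    using lim_imp_Liminf[OF _ tendsto_ennrealI[OF D]] by simp
  finally have "ennreal (\<integral>z. (cmod (G z))\<^sup>2 \<partial>\<nu>) = 0"
    by (subst nn_integral_eq_integral[OF iG, symmetric]) auto
  moreover have "(\<integral>z. (cmod (G z))\<^sup>2 \<partial>\<nu>) \<ge> 0" by (intro integral_nonneg_AE) auto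
  ultimately have G0: "(\<integral>z. (cmod (G z))\<^sup>2 \<partial>\<nu>) = 0" by (simp add: ennreal_eq_0_iff)
  have upper: "(\<integral>z. (cmod (E j z))\<^sup>2 \<partial>\<nu>) \<le> 2 * D j" for j
  proof -
    have "(\<integral>z. (cmod (E j z))\<^sup>2 \<partial>\<nu>) \<le> (\<integral>z. 2 * (cmod (E j z - G z))\<^sup>2 + 2 * (cmod (G z))\<^sup>2 \<partial>\<nu>)"
      using norm2_add_le[of "E j z - G z" "G z" for z]
      by (intro integral_mono iE Bochner_Integration.integrable_add integrable_mult_right iD iG) simp
    then show ?thesis using G0 iD iG by (simp add: D_def)
  qed
  have D2: "(\<lambda>j. 2 * D j) \<longlonglongrightarrow> 0" using tendsto_mult_right_zero[OF D] by simp
  show ?thesis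
    by (rule tendsto_sandwich[OF _ _ tendsto_const D2]) (auto intro!: always_eventually upper integral_nonneg_AE)
qed

lemma vanishing_carleson_imp_hankel_compact:
  assumes an: "conj_symbol_analytic \<Lambda>" and vc: "vanishing_carleson_dirichlet (conj_symbol_measure \<Lambda>)"
  shows "hankel_compact_on_dirichlet \<Lambda>"
proof -
  let ?\<nu> = "conj_symbol_measure \<Lambda>"
  have "disc_series (conj_symbol \<Lambda>) (\<lambda>n. cnj (\<Lambda> n))"
    using an by (auto simp: conj_symbol_analytic_def disc_series_def conj_symbol_def intro: summable_sums)
  \<comment> \<open>A Carleson measure is finite by definition, which puts \<open>h\<close> in the
    Dirichlet space and makes every Hankel series converge.\<close>
  then have L: "dirichlet_symbol \<Lambda>"
    using vc finite_conj_symbol_measure_iff by (simp add: vanishing_carleson_dirichlet_def)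
  have L2: "f \<in> L2_space ?\<nu>" if "f \<in> dirichlet_space" for f
    using vc that by (simp add: vanishing_carleson_dirichlet_def compact_linear_operator_def)
  have int: "integrable disc_area (\<lambda>z. (cmod (f z * deriv (conj_symbol \<Lambda>) z))\<^sup>2)" if "f \<in> dirichlet_space" for f
    using L2[OF that] symbol_measure_integral(1)[OF L dirichlet_measurable[OF that]] by (simp add: L2_space_def)
  have cpt: "\<exists>G\<in>L2_space ?\<nu>. \<exists>s. strict_mono s \<and> (\<lambda>j. L2_norm_on ?\<nu> (\<lambda>z. E (s j) z - G z)) \<longlonglongrightarrow> 0"
    if "\<forall>j. E j \<in> dirichlet_space" "\<exists>C. \<forall>j. dirichlet_norm (E j) \<le> C" for E :: "nat \<Rightarrow> complex \<Rightarrow> complex"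
    using vc that by (simp add: vanishing_carleson_dirichlet_def compact_linear_operator_def)
  note hd = hankel_op_disc_series[OF L]
  note hsum = hankel_coeff_energy_le(1)[OF L _ int]
  have T: "hankel_op \<Lambda> f \<in> dirichlet_space" if "f \<in> dirichlet_space" for f
    using disc_series_dirichlet_iff[OF hd[OF that]] hsum[OF that that] by simp
  have "compact_linear_operator dirichlet_space dirichlet_norm dirichlet_space dirichlet_norm (hankel_op \<Lambda>)"
    unfolding compact_linear_operator_def
  proof (intro conjI allI ballI impI)
    show "hankel_op \<Lambda> f \<in> dirichlet_space" if "f \<in> dirichlet_space" for f using T[OF that] .
  next
    fix f g assume f: "f \<in> dirichlet_space" and g: "g \<in> dirichlet_space"
    show "dirichlet_norm (\<lambda>z. hankel_op \<Lambda> (\<lambda>w. f w + g w) z - (hankel_op \<Lambda> f z + hankel_op \<Lambda> g z)) = 0"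
      using disc_series_diff[OF hd[OF dirichlet_space_add[OF f g]] disc_series_add[OF hd[OF f] hd[OF g]]]
      by (intro dirichlet_norm_eq_0) (simp add: hankel_coeff_add[OF L f g])
  next
    fix f c assume f: "f \<in> dirichlet_space"
    show "dirichlet_norm (\<lambda>z. hankel_op \<Lambda> (\<lambda>w. c * f w) z - c * hankel_op \<Lambda> f z) = 0"
      using disc_series_diff[OF hd[OF dirichlet_space_cmult[OF f]] disc_series_cmult[OF hd[OF f]], of c c]
      by (intro dirichlet_norm_eq_0) (simp add: hankel_coeff_cmult[OF L f])
  next
    fix F :: "nat \<Rightarrow> complex \<Rightarrow> complex"
    assume "(\<forall>j. F j \<in> dirichlet_space) \<and> (\<exists>C. \<forall>j. dirichlet_norm (F j) \<le> C)"
    then obtain C where F: "\<And>j. F j \<in> dirichlet_space" and C: "\<And>j. dirichlet_norm (F j) \<le> C"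
      by blast
    obtain r f where r: "strict_mono r" and f: "f \<in> dirichlet_space" and null: "dirichlet_null (\<lambda>j z. F (r j) z - f z)"
      by (rule dirichlet_bounded_subseq[OF F C]) (rule that)
    define E where "E j z = F (r j) z - f z" for j z
    have E: "dirichlet_null E" using null by (simp add: E_def[abs_def])
    then have Ed: "E j \<in> dirichlet_space" for j by (simp add: dirichlet_null_def)
    obtain G s where G: "G \<in> L2_space ?\<nu>" and s: "strict_mono s"
      and lim: "(\<lambda>j. L2_norm_on ?\<nu> (\<lambda>z. E (s j) z - G z)) \<longlonglongrightarrow> 0"
      using cpt[of E] E unfolding dirichlet_null_def by blast
    note Es = dirichlet_null_subseq[OF E s]
    \<comment> \<open>Weakly null sequences tend to 0 at every point of the disc, so the
      \<open>L^2\<close> limit \<open>G\<close> can only be zero.\<close>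
    have "(\<lambda>j. \<integral>z. (cmod (E (s j) z))\<^sup>2 \<partial>?\<nu>) \<longlonglongrightarrow> 0"
      by (rule L2_limit_of_pointwise_null[OF L2[OF Ed] G _ lim]) (simp add: dirichlet_null_pointwise[OF Es])
    then have int0: "(\<lambda>j. \<integral>z. (cmod (E (s j) z * deriv (conj_symbol \<Lambda>) z))\<^sup>2 \<partial>disc_area) \<longlonglongrightarrow> 0"
      by (simp add: symbol_measure_integral(2)[OF L dirichlet_measurable[OF Ed]])
    have "(\<lambda>j. \<Sum>k. real k * (cmod (hankel_coeff \<Lambda> (E (s j)) k))\<^sup>2) \<longlonglongrightarrow> 0"
      by (rule tendsto_sandwich[OF _ _ tendsto_const int0])
         (auto intro!: always_eventually suminf_nonneg hsum Ed hankel_coeff_energy_le(2)[OF L Ed int])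
    \<comment> \<open>The weight \<open>k\<close> hides the constant coefficient of the image; that
      one tends to zero as the pairing of a weakly null sequence with
      \<open>\<Lambda>\<close>.\<close>
    moreover have "(\<lambda>j. (cmod (hankel_coeff \<Lambda> (E (s j)) 0))\<^sup>2) \<longlonglongrightarrow> 0"
      using tendsto_power[OF tendsto_norm[OF dirichlet_null_hankel_coeff[OF L Es, of 0]], of 2] by simp
    ultimately have "(\<lambda>j. dirichlet_energy (hankel_coeff \<Lambda> (E (s j)))) \<longlonglongrightarrow> 0 + 0"
      unfolding dirichlet_energy_def by (intro tendsto_add)
    then have "(\<lambda>j. sqrt (dirichlet_energy (hankel_coeff \<Lambda> (E (s j))))) \<longlonglongrightarrow> sqrt 0"
      by (intro tendsto_real_sqrt) simp
    \<comment> \<open>By linearity of the coefficients, the energy of the image of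
      \<open>E (s j)\<close> measures the distance to the image of the weak limit \<open>f\<close>,
      which is the limit sought.\<close>
    moreover have "dirichlet_norm (\<lambda>z. hankel_op \<Lambda> (F ((r \<circ> s) j)) z - hankel_op \<Lambda> f z)
        = sqrt (dirichlet_energy (hankel_coeff \<Lambda> (E (s j))))" for j
    proof (rule disc_series_dirichlet_norm)
      have "hankel_coeff \<Lambda> (E (s j)) = (\<lambda>n. hankel_coeff \<Lambda> (F (r (s j))) n - hankel_coeff \<Lambda> f n)"
        unfolding E_def[abs_def] by (rule ext) (rule hankel_coeff_diff[OF L F f])
      then show "disc_series (\<lambda>z. hankel_op \<Lambda> (F ((r \<circ> s) j)) z - hankel_op \<Lambda> f z) (hankel_coeff \<Lambda> (E (s j)))"
        using disc_series_diff[OF hd[OF F] hd[OF f]] by simp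
      show "summable (\<lambda>k. real k * (cmod (hankel_coeff \<Lambda> (E (s j)) k))\<^sup>2)"
        by (rule hsum[OF Ed Ed])
    qed
    ultimately have "(\<lambda>j. dirichlet_norm (\<lambda>z. hankel_op \<Lambda> (F ((r \<circ> s) j)) z - hankel_op \<Lambda> f z)) \<longlonglongrightarrow> 0"
      by simp
    moreover have "strict_mono (r \<circ> s)" using r s by (rule strict_mono_o)
    ultimately show "\<exists>g\<in>dirichlet_space. \<exists>r. strict_mono r
        \<and> (\<lambda>j. dirichlet_norm (\<lambda>z. hankel_op \<Lambda> (F (r j)) z - g z)) \<longlonglongrightarrow> 0"
      using T[OF f] by blast
  qed
  then show ?thesis
    using dirichlet_hankel_well_defined[OF L] by (simp add: hankel_compact_on_dirichlet_def)
qed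

theorem theorem4p1:
  fixes \<Lambda> :: "nat \<Rightarrow> complex"
  shows "hankel_compact_on_dirichlet \<Lambda> \<longleftrightarrow>
    conj_symbol_analytic \<Lambda> \<and> vanishing_carleson_dirichlet (conj_symbol_measure \<Lambda>)"
  using hankel_compact_imp_vanishing_carleson vanishing_carleson_imp_hankel_compact by blast

end
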